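(* Let $G$ be a finitely generated group of polynomial growth, and let $G \curvearrowright X$ be a minimal continuous action on a compact metrizable space $X$. Then the action has comparison: for all open sets $A, B \subseteq X$ such that $\mu(A) < \mu(B)$ for every $G$-invariant Borel probability measure $\mu$ on $X$, we have $A \prec B$.
   Context: For subsets $A, B \subseteq X$, $A$ is subequivalent to $B$, written $A \prec B$, if for every closed set $C \subseteq A$ there are finitely many open sets $U_1, \dots, U_n \subseteq X$ and elements $s_1, \dots, s_n \in G$ such that $C \subseteq \bigcup_{i=1}^n U_i$ and the sets $s_1U_1, \dots, s_nU_n$ are pairwise disjoint and contained in $B$. A finitely generated group has polynomial growth if, for the word metric with respect to some finite symmetric generating set, the balls $B_n$ of radius $n$ about the identity satisfy $|B_n| \le C n^d$ for some constants $C, d$ and all $n \ge 1$. *)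

theory Defs
  imports "HOL-Probability.Probability" "HOL-Algebra.Generated_Groups"
begin

definition word_ball :: "('g, 'b) monoid_scheme \<Rightarrow> 'g set \<Rightarrow> nat \<Rightarrow> 'g set" where
  "word_ball G S n = {foldr (\<otimes>\<^bsub>G\<^esub>) l \<one>\<^bsub>G\<^esub> | l. set l \<subseteq> S \<and> length l \<le> n}"

definition finitely_generated_group :: "('g, 'b) monoid_scheme \<Rightarrow> bool" where
  "finitely_generated_group G \<longleftrightarrow> group G \<and>
     (\<exists>S. finite S \<and> S \<subseteq> carrier G \<and> generate G S = carrier G)"

definition polynomial_growth :: "('g, 'b) monoid_scheme \<Rightarrow> bool" where
  "polynomial_growth G \<longleftrightarrow>
     (\<exists>S. finite S \<and> S \<subseteq> carrier G \<and> (\<forall>s\<in>S. inv\<^bsub>G\<^esub> s \<in> S) \<and>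
          generate G S = carrier G \<and>
          (\<exists>C d::real. \<forall>n::nat. n \<ge> 1 \<longrightarrow> real (card (word_ball G S n)) \<le> C * real n powr d))"

definition continuous_action :: "('g, 'b) monoid_scheme \<Rightarrow> ('g \<Rightarrow> 'x::topological_space \<Rightarrow> 'x) \<Rightarrow> bool" where
  "continuous_action G act \<longleftrightarrow>
     (\<forall>x. act \<one>\<^bsub>G\<^esub> x = x) \<and>
     (\<forall>g\<in>carrier G. \<forall>h\<in>carrier G. \<forall>x. act (g \<otimes>\<^bsub>G\<^esub> h) x = act g (act h x)) \<and>
     (\<forall>g\<in>carrier G. continuous_on UNIV (act g))"

definition minimal_action :: "('g, 'b) monoid_scheme \<Rightarrow> ('g \<Rightarrow> 'x::topological_space \<Rightarrow> 'x) \<Rightarrow> bool" where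
  "minimal_action G act \<longleftrightarrow>
     (\<forall>Y. closed Y \<and> (\<forall>g\<in>carrier G. act g ` Y \<subseteq> Y) \<longrightarrow> Y = {} \<or> Y = UNIV)"

definition invariant_prob_measure ::
  "('g, 'b) monoid_scheme \<Rightarrow> ('g \<Rightarrow> 'x::topological_space \<Rightarrow> 'x) \<Rightarrow> 'x measure \<Rightarrow> bool" where
  "invariant_prob_measure G act \<mu> \<longleftrightarrow>
     prob_space \<mu> \<and> sets \<mu> = sets borel \<and>
     (\<forall>g\<in>carrier G. \<forall>A\<in>sets borel. measure \<mu> (act g -` A) = measure \<mu> A)"

definition subequivalent ::
  "('g, 'b) monoid_scheme \<Rightarrow> ('g \<Rightarrow> 'x::topological_space \<Rightarrow> 'x) \<Rightarrow> 'x set \<Rightarrow> 'x set \<Rightarrow> bool" where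
  "subequivalent G act A B \<longleftrightarrow>
     (\<forall>C. closed C \<and> C \<subseteq> A \<longrightarrow>
        (\<exists>n::nat. \<exists>U :: nat \<Rightarrow> 'x set. \<exists>s :: nat \<Rightarrow> 'g.
           (\<forall>i<n. open (U i) \<and> s i \<in> carrier G \<and> act (s i) ` U i \<subseteq> B) \<and>
           C \<subseteq> (\<Union>i<n. U i) \<and>
           (\<forall>i<n. \<forall>j<n. i \<noteq> j \<longrightarrow> act (s i) ` U i \<inter> act (s j) ` U j = {})))"

end

(* The idea is to match greedily, in a fixed order g_0, g_1, ... of the group: at step k, the part of
   the closed set C not yet matched is sent by g_k into what is left of the open target B.  Small open
   neighbourhoods must be used instead of the matched sets themselves, so points on the boundary of a
   piece use up room in B without being matched.  If the sizes of the neighbourhoods decrease fast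
   enough, the used points of B (away from the boundary of B) can nevertheless be charged injectively,
   along orbits, to points near C.

   Run over the whole group, the procedure leaves a closed set that is null for every invariant measure
   mu: otherwise, on the saturation of that set, all of B would be used, and mu(B) <= mu(C) there.  So
   after finitely many steps the rest is uniformly small.  It is matched by a second greedy procedure
   into a small open ball V that was kept free inside B.  If the elements of G are now taken by word
   length and x is never matched, the points of V in the n-ball of the orbit of x are at most as many as
   the points of the rest in the 2n-ball.  Polynomial growth bounds the ratio of the sizes of these balls
   for suitable n, and the limit of the counting measures is an invariant measure contradicting the
   smallness of the rest. *)

theory Submission
  imports Defs
begin

section \<open>Measures from finitely additive contents\<close>

text \<open>A limit of probability measures along a filter, taken set by set, is only finitely
  additive. The locale collects what survives in such a limit and replaces it by a Borel measure
  comparable with it on open and on closed sets.\<close>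

locale borel_content =
  fixes m :: "'x::metric_space set \<Rightarrow> real"
  assumes compact_UNIV: "compact (UNIV :: 'x set)"
    and nonneg: "0 \<le> m A"
    and add: "A \<in> sets borel \<Longrightarrow> B \<in> sets borel \<Longrightarrow> A \<inter> B = {} \<Longrightarrow> m (A \<union> B) = m A + m B"
    and total: "m UNIV = 1"
begin

text \<open>\<open>inner\<close> and \<open>outer\<close> are the two steps of the classical
  construction of a Radon measure from a content on compact sets; as the whole space is compact,
  closed sets take the place of compact ones.\<close>

definition inner :: "'x set \<Rightarrow> ennreal" where
  "inner U = (SUP K\<in>{K. closed K \<and> K \<subseteq> U}. ennreal (m K))"

definition outer :: "'x set \<Rightarrow> ennreal" where
  "outer A = (INF U\<in>{U. open U \<and> A \<subseteq> U}. inner U)"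

lemma content_empty: "m {} = 0"
  using add[of "{}" "{}"] by simp

lemma content_mono:
  assumes "A \<in> sets borel" "B \<in> sets borel" "A \<subseteq> B"
  shows "m A \<le> m B"
proof -
  have "m (A \<union> (B - A)) = m A + m (B - A)"
    using assms by (intro add) auto
  moreover have "A \<union> (B - A) = B" using assms by auto
  ultimately show ?thesis using nonneg[of "B - A"] by simp
qed

lemma content_subadditive:
  assumes "finite I" "\<And>i. i \<in> I \<Longrightarrow> A i \<in> sets borel"
  shows "m (\<Union>i\<in>I. A i) \<le> (\<Sum>i\<in>I. m (A i))"
  using assms
proof (induction I rule: finite_induct)
  case empty
  then show ?case by (simp add: content_empty)
next
  case (insert i I)
  let ?R = "\<Union>j\<in>I. A j"
  have R: "?R \<in> sets borel" using insert by (intro sets.finite_UN) auto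
  have "m (A i \<union> (?R - A i)) = m (A i) + m (?R - A i)"
    using insert R by (intro add) auto
  also have "m (?R - A i) \<le> m ?R"
    using insert R by (intro content_mono) auto
  also have "A i \<union> (?R - A i) = (\<Union>j\<in>insert i I. A j)" by auto
  finally show ?case using insert by fastforce
qed

lemma inner_upper: "closed K \<Longrightarrow> K \<subseteq> U \<Longrightarrow> ennreal (m K) \<le> inner U"
  unfolding inner_def by (rule SUP_upper) auto

lemma inner_mono: "U \<subseteq> V \<Longrightarrow> inner U \<le> inner V"
  unfolding inner_def by (rule SUP_subset_mono) auto

lemma inner_le: "open U \<Longrightarrow> inner U \<le> ennreal (m U)"
  unfolding inner_def by (rule SUP_least) (auto intro!: ennreal_leI content_mono)

lemma outer_open: "open U \<Longrightarrow> outer U = inner U"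
  unfolding outer_def by (intro antisym INF_lower INF_greatest inner_mono) auto

lemma outer_mono: "A \<subseteq> B \<Longrightarrow> outer A \<le> outer B"
  unfolding outer_def by (rule INF_superset_mono) auto

lemma outer_le: "open U \<Longrightarrow> A \<subseteq> U \<Longrightarrow> outer A \<le> inner U"
  unfolding outer_def by (rule INF_lower) auto

lemma outer_empty: "outer {} = 0"
  using inner_le[of "{}"] by (simp add: outer_open content_empty)

lemma le_outer_closed: "closed K \<Longrightarrow> ennreal (m K) \<le> outer K"
  unfolding outer_def by (rule INF_greatest) (auto intro: inner_upper)

text \<open>Compactness reduces the cover of a closed set to a finite one, and the closed set is
  then cut into finitely many closed pieces, each inside a single \<open>U j\<close>.\<close>

lemma inner_countably_subadditive:
  fixes U :: "nat \<Rightarrow> 'x set"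
  assumes "\<And>i. open (U i)"
  shows "inner (\<Union>i. U i) \<le> (\<Sum>i. inner (U i))"
  unfolding inner_def[of "\<Union>i. U i"]
proof (rule SUP_least)
  fix K assume "K \<in> {K. closed K \<and> K \<subseteq> (\<Union>i. U i)}"
  then have K: "closed K" "K \<subseteq> (\<Union>i. U i)" by auto
  have "\<exists>p. 0 < snd p \<and> cball x (snd p) \<subseteq> U (fst p)" if x: "x \<in> K" for x
  proof -
    obtain j where "x \<in> U j" using K x by auto
    then obtain e where "0 < e" "cball x e \<subseteq> U j"
      using assms open_contains_cball by blast
    then show ?thesis by (intro exI[of _ "(j, e)"]) auto
  qed
  then obtain p where p: "\<forall>x\<in>K. 0 < snd (p x) \<and> cball x (snd (p x)) \<subseteq> U (fst (p x))"
    using bchoice[of K "\<lambda>x p. 0 < snd p \<and> cball x (snd p) \<subseteq> U (fst p)"] by auto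
  define i where "i x = fst (p x)" for x
  define r where "r x = snd (p x)" for x
  have ir: "0 < r x \<and> cball x (r x) \<subseteq> U (i x)" if "x \<in> K" for x
    using p that by (auto simp: i_def r_def)
  have "compact K"
    using K compact_UNIV closed_Int_compact by (metis Int_UNIV_right)
  moreover have "K \<subseteq> (\<Union>x\<in>K. ball x (r x))" using ir by force
  ultimately obtain D where D: "D \<subseteq> K" "finite D" "K \<subseteq> (\<Union>x\<in>D. ball x (r x))"
    using compactE_image[of K K "\<lambda>x. ball x (r x)"] by (metis open_ball)
  \<comment> \<open>The radii were chosen so that even the closed balls stay inside one member of
    the cover; grouping them by that member gives closed pieces of \<open>K\<close>.\<close>
  define L where "L j = K \<inter> (\<Union>x\<in>{x\<in>D. i x = j}. cball x (r x))" for j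
  have L: "closed (L j)" "L j \<subseteq> U j" for j
    using K(1) D ir unfolding L_def by (auto intro!: closed_Int closed_UN)
  have "K = (\<Union>j\<in>i ` D. L j)"
    using D(3) unfolding L_def by (fastforce intro: less_imp_le)
  then have "m K \<le> (\<Sum>j\<in>i ` D. m (L j))"
    using content_subadditive[of "i ` D" L] D(2) L(1) by auto
  then have "ennreal (m K) \<le> (\<Sum>j\<in>i ` D. ennreal (m (L j)))"
    by (simp add: nonneg ennreal_leI)
  also have "\<dots> \<le> (\<Sum>j\<in>i ` D. inner (U j))"
    by (intro sum_mono inner_upper L)
  also have "\<dots> \<le> (\<Sum>j. inner (U j))"
    using D(2) by (intro sum_le_suminf) auto
  finally show "ennreal (m K) \<le> (\<Sum>j. inner (U j))" .
qed

lemma outer_finite: "outer A \<noteq> \<top>"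
proof -
  have "outer A \<le> inner UNIV" by (rule outer_le) auto
  also have "\<dots> \<le> ennreal (m UNIV)" by (rule inner_le) auto
  finally show ?thesis by (auto simp: top_unique)
qed

lemma outer_countably_subadditive:
  fixes A :: "nat \<Rightarrow> 'x set"
  shows "outer (\<Union>i. A i) \<le> (\<Sum>i. outer (A i))"
proof (rule ennreal_le_epsilon)
  fix e :: real assume e: "0 < e"
  have "\<exists>U. open U \<and> A n \<subseteq> U \<and> inner U \<le> outer (A n) + e * (1/2) ^ Suc n" for n
  proof -
    have "outer (A n) < outer (A n) + e * (1/2) ^ Suc n"
      using e outer_finite[of "A n"] by (simp add: less_top)
    then have "\<exists>U\<in>{U. open U \<and> A n \<subseteq> U}. inner U < outer (A n) + e * (1/2) ^ Suc n"
      unfolding outer_def[of "A n"] INF_less_iff .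
    then show ?thesis by (auto intro: less_imp_le)
  qed
  then obtain U where U: "\<And>n. open (U n)" "\<And>n. A n \<subseteq> U n"
      "\<And>n. inner (U n) \<le> outer (A n) + e * (1/2) ^ Suc n"
    by metis
  have "outer (\<Union>i. A i) \<le> inner (\<Union>i. U i)"
    using U by (intro outer_le) auto
  also have "\<dots> \<le> (\<Sum>n. inner (U n))"
    by (rule inner_countably_subadditive) (rule U)
  also have "\<dots> \<le> (\<Sum>n. outer (A n) + e * (1/2) ^ Suc n)"
    by (intro suminf_le U) auto
  also have "\<dots> = (\<Sum>n. outer (A n)) + (\<Sum>n. ennreal e * ennreal ((1/2) ^ Suc n))"
    using \<open>0 < e\<close> by (subst suminf_add[symmetric])
      (auto simp del: ennreal_suminf_cmult simp add: ennreal_mult[symmetric])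
  also have "\<dots> = (\<Sum>n. outer (A n)) + e"
    unfolding ennreal_suminf_cmult
    by (subst suminf_ennreal_eq[OF zero_le_power power_half_series]) auto
  finally show "outer (\<Union>i. A i) \<le> (\<Sum>n. outer (A n)) + e" .
qed

lemma outer_subadditive: "outer (A \<union> B) \<le> outer A + outer B"
proof -
  define F :: "nat \<Rightarrow> 'x set" where "F n = (if n = 0 then A else if n = 1 then B else {})" for n
  have "A \<union> B = (\<Union>n. F n)" by (auto simp: F_def split: if_splits)
  then have "outer (A \<union> B) \<le> (\<Sum>n. outer (F n))"
    by (simp add: outer_countably_subadditive)
  also have "\<dots> = (\<Sum>n\<in>{0, 1}. outer (F n))"
    by (rule suminf_finite) (auto simp: F_def outer_empty)
  finally show ?thesis by (simp add: F_def)
qed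

lemma outer_space: "outer_measure_space (Pow UNIV) outer"
  by (auto simp: outer_measure_space_def positive_def increasing_def countably_subadditive_def
      outer_empty outer_mono outer_countably_subadditive)

text \<open>For open \<open>U\<close> containing \<open>A\<close>, take a closed \<open>K\<close>
  inside \<open>U \<inter> V\<close> and then a closed \<open>L\<close> inside \<open>U - K\<close>.
  These are disjoint, so additivity bounds \<open>m K + m L\<close> by \<open>inner U\<close>.
  Suprema over \<open>L\<close> and then over \<open>K\<close> give the criterion of
  Caratheodory.\<close>

lemma open_in_lambda_system:
  assumes V: "open V"
  shows "V \<in> lambda_system UNIV (Pow UNIV) outer"
proof -
  have "outer (V \<inter> A) + outer ((UNIV - V) \<inter> A) = outer A" for A
  proof (rule antisym)
    show "outer (V \<inter> A) + outer ((UNIV - V) \<inter> A) \<le> outer A"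
      unfolding outer_def[of A]
    proof (rule INF_greatest)
      fix U assume "U \<in> {U. open U \<and> A \<subseteq> U}"
      then have U: "open U" "A \<subseteq> U" by auto
      have *: "ennreal (m K) + outer (U - V) \<le> inner U" if K: "closed K" "K \<subseteq> U \<inter> V" for K
      proof -
        have "outer (U - V) \<le> inner (U - K)"
          using U K by (intro outer_le open_Diff) auto
        moreover have "ennreal (m K) + inner (U - K) =
            (SUP L\<in>{L. closed L \<and> L \<subseteq> U - K}. ennreal (m K) + ennreal (m L))"
          unfolding inner_def by (rule ennreal_SUP_add_right) auto
        moreover have "\<dots> \<le> inner U"
        proof (rule SUP_least)
          fix L assume "L \<in> {L. closed L \<and> L \<subseteq> U - K}"
          then have L: "closed L" "L \<subseteq> U - K" by auto
          have "ennreal (m K) + ennreal (m L) = ennreal (m (K \<union> L))"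
            using K L by (subst add) (auto simp: nonneg)
          also have "\<dots> \<le> inner U" using K L by (intro inner_upper) auto
          finally show "ennreal (m K) + ennreal (m L) \<le> inner U" .
        qed
        ultimately show ?thesis by (metis add_left_mono order_trans)
      qed
      have "outer (V \<inter> A) + outer ((UNIV - V) \<inter> A) \<le> inner (U \<inter> V) + outer (U - V)"
        using U V by (intro add_mono outer_le outer_mono) auto
      also have "inner (U \<inter> V) + outer (U - V) =
          (SUP K\<in>{K. closed K \<and> K \<subseteq> U \<inter> V}. ennreal (m K) + outer (U - V))"
        unfolding inner_def by (rule ennreal_SUP_add_left[symmetric]) auto
      also have "\<dots> \<le> inner U"
        by (rule SUP_least) (use * in auto)
      finally show "outer (V \<inter> A) + outer ((UNIV - V) \<inter> A) \<le> inner U" .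
    qed
    have "A = (V \<inter> A) \<union> ((UNIV - V) \<inter> A)" by auto
    then show "outer A \<le> outer (V \<inter> A) + outer ((UNIV - V) \<inter> A)"
      using outer_subadditive by metis
  qed
  then show ?thesis by (simp add: lambda_system_def)
qed

text \<open>Mass of \<open>m\<close> may sit arbitrarily close to a set without being in it, so
  equality with \<open>m\<close> is lost in general; what can be kept is one inequality for closed
  sets and the opposite one for open sets.\<close>

lemma regularization:
  obtains \<mu> where "prob_space \<mu>" "sets \<mu> = sets borel"
    "\<And>A. A \<in> sets borel \<Longrightarrow> emeasure \<mu> A = outer A"
    "\<And>K. closed K \<Longrightarrow> m K \<le> measure \<mu> K" "\<And>U. open U \<Longrightarrow> measure \<mu> U \<le> m U"
proof -
  interpret sigma_algebra "UNIV :: 'x set" "Pow UNIV" by (rule sigma_algebra_Pow)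
  let ?L = "lambda_system UNIV (Pow UNIV) outer"
  have L: "measure_space UNIV ?L outer" by (rule caratheodory_lemma[OF outer_space])
  then interpret L: sigma_algebra UNIV ?L by (simp add: measure_space_def)
  have "sets borel \<subseteq> ?L"
    unfolding sets_borel by (intro L.sigma_sets_subset) (use open_in_lambda_system in auto)
  then have ms: "measure_space UNIV (sets borel) outer"
    using measure_down[OF L] sets.sigma_algebra_axioms[of "borel :: 'x measure"] by auto
  define \<mu> where "\<mu> = measure_of UNIV (sets (borel :: 'x measure)) outer"
  have em: "emeasure \<mu> A = outer A" if "A \<in> sets borel" for A
    unfolding \<mu>_def using ms that
    by (intro emeasure_measure_of_sigma) (auto simp: measure_space_def)
  have sets: "sets \<mu> = sets borel"
    unfolding \<mu>_def using sets.sigma_sets_eq[of "borel :: 'x measure"] by (auto simp: sets_measure_of_conv)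
  have space: "space \<mu> = UNIV" unfolding \<mu>_def by (simp add: space_measure_of_conv)
  have "outer UNIV \<le> 1"
    using inner_le[of UNIV] by (simp add: outer_open total)
  moreover have "1 \<le> outer UNIV"
    using le_outer_closed[of UNIV] by (simp add: total)
  ultimately have prob: "prob_space \<mu>"
    by (intro prob_spaceI) (simp add: space em)
  interpret prob_space \<mu> by (rule prob)
  show thesis
  proof (rule that[OF prob sets em])
    show "m K \<le> measure \<mu> K" if "closed K" for K
      using le_outer_closed[OF that] that em[of K]
      by (simp add: emeasure_eq_measure) (metis ennreal_le_iff measure_nonneg)
    show "measure \<mu> U \<le> m U" if "open U" for U
      using inner_le[OF that] that em[of U]
      by (simp add: emeasure_eq_measure outer_open) (metis ennreal_le_iff nonneg)
  qed
qed

text \<open>A homeomorphism permutes the closed sets and the open sets, hence the families over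
  which the supremum and the infimum are taken.\<close>

lemma outer_vimage:
  assumes f: "continuous_on UNIV f" "continuous_on UNIV h" "\<And>x. h (f x) = x" "\<And>x. f (h x) = x"
    and inv: "\<And>K. closed K \<Longrightarrow> m (f -` K) = m K"
  shows "outer (f -` A) = outer A"
proof -
  have op: "open (f -` U)" "open (h -` U)" if "open U" for U
    using that f by (auto intro: open_vimage)
  have cl: "closed (f -` U)" "closed (h -` U)" if "closed U" for U
    using that f by (auto intro: closed_vimage)
  have fh: "f -` h -` U = U" "h -` f -` U = U" for U using f by auto
  have "inner (f -` U) = inner U" for U
    unfolding inner_def
  proof (intro SUP_eq)
    fix K assume K: "K \<in> {K. closed K \<and> K \<subseteq> f -` U}"
    then have "m (h -` K) = m K" using inv[of "h -` K"] cl fh by auto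
    then show "\<exists>j\<in>{K. closed K \<and> K \<subseteq> U}. ennreal (m K) \<le> ennreal (m j)"
      using K cl f(4) by (intro bexI[of _ "h -` K"]) fastforce+
  next
    fix K assume K: "K \<in> {K. closed K \<and> K \<subseteq> U}"
    then show "\<exists>i\<in>{K. closed K \<and> K \<subseteq> f -` U}. ennreal (m K) \<le> ennreal (m i)"
      using inv[of K] cl by (intro bexI[of _ "f -` K"]) auto
  qed
  note inner = this
  show ?thesis
    unfolding outer_def
  proof (intro INF_eq)
    fix U assume U: "U \<in> {U. open U \<and> A \<subseteq> U}"
    then show "\<exists>i\<in>{U. open U \<and> f -` A \<subseteq> U}. inner i \<le> inner U"
      using op inner by (intro bexI[of _ "f -` U"]) auto
  next
    fix U assume U: "U \<in> {U. open U \<and> f -` A \<subseteq> U}"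
    then show "\<exists>j\<in>{U. open U \<and> A \<subseteq> U}. inner j \<le> inner U"
      using op inner[of "h -` U"] fh f by (intro bexI[of _ "h -` U"]) fastforce+
  qed
qed

end

section \<open>Limits of almost invariant set functions\<close>

text \<open>Tychonoff's theorem for functions from \<open>'b\<close> to the unit interval. A filter
  is used because \<open>'b\<close> will be the type of all subsets, too large in general for
  convergent subsequences to exist.\<close>

lemma pointwise_cluster:
  fixes \<nu> :: "nat \<Rightarrow> 'b \<Rightarrow> real"
  assumes "\<And>n A. 0 \<le> \<nu> n A" "\<And>n A. \<nu> n A \<le> 1"
  obtains m F where "F \<noteq> bot" "F \<le> filtermap \<nu> sequentially"
    "\<And>A. ((\<lambda>f. f A) \<longlongrightarrow> m A) F"
proof -
  let ?K = "PiE UNIV (\<lambda>_::'b. {0..1::real})"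
  have "compactin (product_topology (\<lambda>_. euclidean) UNIV) ?K"
    unfolding compactin_PiE by auto
  then have "compact ?K" by (simp add: euclidean_product_topology)
  moreover have "\<forall>\<^sub>F f in filtermap \<nu> sequentially. f \<in> ?K"
    using assms by (auto simp: eventually_filtermap PiE_UNIV_domain)
  moreover have "filtermap \<nu> sequentially \<noteq> bot" by (simp add: filtermap_bot_iff)
  ultimately obtain m where m: "inf (nhds m) (filtermap \<nu> sequentially) \<noteq> bot"
    using compact_filter[of ?K] by blast
  have "((\<lambda>f. f A) \<longlongrightarrow> m A) (nhds m)" for A
    using continuous_on_tendsto_compose[OF continuous_on_product_coordinates[of A], of "\<lambda>f. f" m "nhds m"]
    by (simp add: filterlim_ident)
  then have "((\<lambda>f. f A) \<longlongrightarrow> m A) (inf (nhds m) (filtermap \<nu> sequentially))" for A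
    by (rule tendsto_mono[rotated]) simp
  then show thesis using m by (intro that) auto
qed

locale compact_action = group G for G (structure) +
  fixes act :: "'a \<Rightarrow> 'x::metric_space \<Rightarrow> 'x"
  assumes compact_UNIV: "compact (UNIV :: 'x set)"
    and action: "continuous_action G act"
begin

lemma act_one [simp]: "act \<one> x = x"
  using action by (simp add: continuous_action_def)

lemma act_mult: "g \<in> carrier G \<Longrightarrow> h \<in> carrier G \<Longrightarrow> act (g \<otimes> h) x = act g (act h x)"
  using action by (simp add: continuous_action_def)

lemma act_continuous: "g \<in> carrier G \<Longrightarrow> continuous_on UNIV (act g)"
  using action by (simp add: continuous_action_def)

lemma act_inv [simp]:
  assumes "g \<in> carrier G"
  shows "act (inv g) (act g x) = x" "act g (act (inv g) x) = x"
  using assms act_mult[of g "inv g" x] act_mult[of "inv g" g x] by auto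

lemma inj_act: "g \<in> carrier G \<Longrightarrow> inj (act g)"
  by (metis act_inv(1) injI)

lemma act_image: "g \<in> carrier G \<Longrightarrow> act g ` A = act (inv g) -` A"
  by (auto simp: image_iff) (metis act_inv(2))

lemma act_vimage_open: "g \<in> carrier G \<Longrightarrow> open A \<Longrightarrow> open (act g -` A)"
  using act_continuous open_vimage by blast

lemma act_vimage_closed: "g \<in> carrier G \<Longrightarrow> closed A \<Longrightarrow> closed (act g -` A)"
  using act_continuous closed_vimage by blast

lemma act_image_closed: "g \<in> carrier G \<Longrightarrow> closed A \<Longrightarrow> closed (act g ` A)"
  by (simp add: act_image act_vimage_closed)

lemma act_measurable: "g \<in> carrier G \<Longrightarrow> act g \<in> borel_measurable borel"
  using act_continuous borel_measurable_continuous_onI by blast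

lemma act_vimage_borel: "g \<in> carrier G \<Longrightarrow> A \<in> sets borel \<Longrightarrow> act g -` A \<in> sets borel"
  using measurable_sets[OF act_measurable, of g A] by simp

abbreviation invariant :: "'x measure \<Rightarrow> bool" where
  "invariant \<mu> \<equiv> invariant_prob_measure G act \<mu>"

lemma invariantD:
  assumes "invariant \<mu>"
  shows "prob_space \<mu>" "sets \<mu> = sets borel" "space \<mu> = UNIV"
    "g \<in> carrier G \<Longrightarrow> A \<in> sets borel \<Longrightarrow> measure \<mu> (act g -` A) = measure \<mu> A"
  using assms sets_eq_imp_space_eq[of \<mu> borel] by (auto simp: invariant_prob_measure_def)

text \<open>Weak convergence in the manner of the portmanteau theorem: an eventual inequality
  survives in the limit if its smaller side is tested on an open set and its larger side on a closed
  one. The constant \<open>c\<close> allows for a gap.\<close>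

definition limit_measure :: "(nat \<Rightarrow> 'x set \<Rightarrow> real) \<Rightarrow> 'x measure \<Rightarrow> bool" where
  "limit_measure \<nu> \<mu> \<longleftrightarrow> invariant \<mu> \<and>
    (\<forall>K V c. closed K \<longrightarrow> open V \<longrightarrow> (\<forall>\<^sub>F n in sequentially. \<nu> n V + c \<le> \<nu> n K) \<longrightarrow>
      measure \<mu> V + c \<le> measure \<mu> K)"

lemma limit_measureD:
  assumes "limit_measure \<nu> \<mu>" "closed K" "open V"
    and "\<forall>\<^sub>F n in sequentially. \<nu> n V + c \<le> \<nu> n K"
  shows "measure \<mu> V + c \<le> measure \<mu> K"
  using assms by (auto simp: limit_measure_def)

text \<open>The defect of invariance tends to 0, so a cluster point \<open>m\<close> is exactly
  invariant, and it is finitely additive. Its regularization lies below \<open>m\<close> on the open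
  \<open>V\<close> and above \<open>m\<close> on the closed \<open>K\<close>, which is the direction
  in which the limit inequality is preserved.\<close>

lemma invariant_limit:
  fixes \<nu> :: "nat \<Rightarrow> 'x set \<Rightarrow> real"
  assumes bounds: "\<And>n A. 0 \<le> \<nu> n A" "\<And>n A. \<nu> n A \<le> 1" "\<And>n. \<nu> n UNIV = 1"
    and add: "\<And>n A B. A \<in> sets borel \<Longrightarrow> B \<in> sets borel \<Longrightarrow> A \<inter> B = {} \<Longrightarrow> \<nu> n (A \<union> B) = \<nu> n A + \<nu> n B"
    and inv: "\<And>g A. g \<in> carrier G \<Longrightarrow> A \<in> sets borel \<Longrightarrow> (\<lambda>n. \<nu> n (act g -` A) - \<nu> n A) \<longlonglongrightarrow> 0"
  obtains \<mu> where "limit_measure \<nu> \<mu>"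
proof -
  obtain m F where F: "F \<noteq> bot" "F \<le> filtermap \<nu> sequentially"
    and lim: "\<And>A. ((\<lambda>f. f A) \<longlongrightarrow> m A) F"
    using pointwise_cluster[of \<nu>, OF bounds(1,2)] by blast
  have ev: "\<forall>\<^sub>F f in F. P f" if "\<forall>\<^sub>F n in sequentially. P (\<nu> n)" for P
    using that F(2) by (auto simp: eventually_filtermap le_filter_def)
  have m_inv: "m (act g -` A) = m A" if "g \<in> carrier G" "A \<in> sets borel" for g A
  proof -
    have "filterlim (\<lambda>f. f (act g -` A) - f A) (nhds 0) (filtermap \<nu> sequentially)"
      using inv[OF that] by (simp add: filterlim_filtermap)
    then have "((\<lambda>f. f (act g -` A) - f A) \<longlongrightarrow> 0) F"
      using F(2) tendsto_mono by blast
    moreover have "((\<lambda>f. f (act g -` A) - f A) \<longlongrightarrow> m (act g -` A) - m A) F"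
      by (intro tendsto_intros lim)
    ultimately have "m (act g -` A) - m A = 0"
      using tendsto_unique F(1) by blast
    then show ?thesis by simp
  qed
  interpret borel_content m
  proof
    show "compact (UNIV :: 'x set)" by (rule compact_UNIV)
    show "0 \<le> m A" for A
      by (rule tendsto_lowerbound[OF lim _ F(1)], rule ev) (simp add: bounds)
    show "m (A \<union> B) = m A + m B" if "A \<in> sets borel" "B \<in> sets borel" "A \<inter> B = {}" for A B
    proof (rule tendsto_unique[OF F(1)])
      show "((\<lambda>f. f A + f B) \<longlongrightarrow> m A + m B) F" by (intro tendsto_intros lim)
      show "((\<lambda>f. f A + f B) \<longlongrightarrow> m (A \<union> B)) F"
        by (rule Lim_transform_eventually[OF lim], rule ev) (simp add: add[OF that])
    qed
    show "m UNIV = 1"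
    proof (rule tendsto_unique[OF F(1)])
      show "((\<lambda>f. 1) \<longlongrightarrow> 1) F" by simp
      show "((\<lambda>f. 1) \<longlongrightarrow> m UNIV) F"
        by (rule Lim_transform_eventually[OF lim], rule ev) (simp add: bounds)
    qed
  qed
  obtain \<mu> where \<mu>: "prob_space \<mu>" "sets \<mu> = sets borel"
    "\<And>A. A \<in> sets borel \<Longrightarrow> emeasure \<mu> A = outer A"
    "\<And>K. closed K \<Longrightarrow> m K \<le> measure \<mu> K" "\<And>U. open U \<Longrightarrow> measure \<mu> U \<le> m U"
    using regularization by blast
  have "measure \<mu> (act g -` A) = measure \<mu> A" if "g \<in> carrier G" "A \<in> sets borel" for g A
    using \<mu>(3) that outer_vimage[of "act g" "act (inv g)" A] m_inv act_continuous act_vimage_borel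
    by (auto simp: measure_def)
  then have inv: "invariant \<mu>" using \<mu> by (simp add: invariant_prob_measure_def)
  moreover have "measure \<mu> V + c \<le> measure \<mu> K"
    if "closed K" "open V" and le: "\<forall>\<^sub>F n in sequentially. \<nu> n V + c \<le> \<nu> n K" for K V c
  proof -
    have "m V + c \<le> m K"
    proof (rule tendsto_le[OF F(1)])
      show "((\<lambda>f. f K) \<longlongrightarrow> m K) F" by (rule lim)
      show "((\<lambda>f. f V + c) \<longlongrightarrow> m V + c) F" by (intro tendsto_intros lim)
      show "\<forall>\<^sub>F f in F. f V + c \<le> f K" by (rule ev) (rule le)
    qed
    then show ?thesis using \<mu>(4)[OF that(1)] \<mu>(5)[OF that(2)] by simp
  qed
  ultimately show thesis by (intro that) (auto simp: limit_measure_def)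
qed

text \<open>This is the compactness of the set of invariant probability measures; it serves to make
  statements uniform over all of them.\<close>

lemma invariant_measure_limit:
  assumes "\<And>n. invariant (M n)"
  obtains \<mu> where "limit_measure (\<lambda>n. measure (M n)) \<mu>"
proof -
  note M = invariantD[OF assms]
  show thesis
  proof (rule invariant_limit[of "\<lambda>n. measure (M n)"])
    show "0 \<le> measure (M n) A" "measure (M n) A \<le> 1" "measure (M n) UNIV = 1" for n A
      using prob_space.prob_le_1[OF M(1)] prob_space.prob_space[OF M(1), of n] M(3)[of n] by auto
    show "measure (M n) (A \<union> B) = measure (M n) A + measure (M n) B"
      if "A \<in> sets borel" "B \<in> sets borel" "A \<inter> B = {}" for n A B
      using that finite_measure.finite_measure_Union[of "M n" A B] M(1,2)[of n]
      by (auto simp: prob_space_def)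
    show "(\<lambda>n. measure (M n) (act g -` A) - measure (M n) A) \<longlonglongrightarrow> 0"
      if "g \<in> carrier G" "A \<in> sets borel" for g A
      using M(4)[OF that] by simp
  qed (rule that)
qed

section \<open>Closed neighbourhoods and cores, at a scale common to all invariant measures\<close>

definition outer_nbhd :: "real \<Rightarrow> 'x set \<Rightarrow> 'x set" where
  "outer_nbhd \<epsilon> K = {x. \<exists>y\<in>K. dist x y \<le> \<epsilon>}"

text \<open>For positive \<open>\<epsilon>\<close> these are the points at distance at least
  \<open>\<epsilon>\<close> from the complement of \<open>V\<close>; using open balls makes the set
  closed for every \<open>V\<close>.\<close>

definition inner_core :: "real \<Rightarrow> 'x set \<Rightarrow> 'x set" where
  "inner_core \<epsilon> V = {y. ball y \<epsilon> \<subseteq> V}"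

lemma outer_nbhd_mono: "\<epsilon> \<le> \<epsilon>' \<Longrightarrow> outer_nbhd \<epsilon> K \<subseteq> outer_nbhd \<epsilon>' K"
  unfolding outer_nbhd_def by (blast intro: order_trans)

lemma inner_core_antimono: "\<epsilon> \<le> \<epsilon>' \<Longrightarrow> inner_core \<epsilon>' V \<subseteq> inner_core \<epsilon> V"
  unfolding inner_core_def by fastforce

text \<open>The neighbourhood is the projection of a compact set of pairs.\<close>

lemma closed_outer_nbhd:
  assumes "closed K"
  shows "closed (outer_nbhd \<epsilon> K)"
proof -
  have K: "compact K" using assms compact_UNIV closed_Int_compact by (metis Int_UNIV_right)
  have "closed {p :: 'x \<times> 'x. dist (fst p) (snd p) \<le> \<epsilon>}"
    by (intro closed_Collect_le continuous_intros)
  then have "compact ({p. dist (fst p) (snd p) \<le> \<epsilon>} \<inter> (UNIV \<times> K))"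
    using compact_Times[OF compact_UNIV K] by (rule closed_Int_compact)
  then have "compact (fst ` ({p. dist (fst p) (snd p) \<le> \<epsilon>} \<inter> (UNIV \<times> K)))"
    by (rule compact_continuous_image[rotated]) (intro continuous_intros)
  moreover have "fst ` ({p. dist (fst p) (snd p) \<le> \<epsilon>} \<inter> (UNIV \<times> K)) = outer_nbhd \<epsilon> K"
    by (force simp: outer_nbhd_def image_iff)
  ultimately show ?thesis by (simp add: compact_imp_closed)
qed

lemma closed_inner_core: "closed (inner_core \<epsilon> V)"
proof -
  have "- inner_core \<epsilon> V = (\<Union>z\<in>- V. ball z \<epsilon>)"
    unfolding inner_core_def by (auto simp: dist_commute)
  then show ?thesis by (metis closed_def open_UN open_ball)
qed

lemma inner_core_subset: "0 < \<epsilon> \<Longrightarrow> inner_core \<epsilon> V \<subseteq> V"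
  unfolding inner_core_def by force

lemma subset_inner_core_interior:
  assumes "0 < \<epsilon>" "ball x (2 * \<epsilon>) \<subseteq> V"
  shows "x \<in> interior (inner_core \<epsilon> V)"
proof -
  have "ball x \<epsilon> \<subseteq> inner_core \<epsilon> V"
  proof
    fix y assume y: "y \<in> ball x \<epsilon>"
    have "ball y \<epsilon> \<subseteq> ball x (2 * \<epsilon>)"
    proof
      fix z assume "z \<in> ball y \<epsilon>"
      then show "z \<in> ball x (2 * \<epsilon>)" using y dist_triangle[of x z y] by auto
    qed
    then show "y \<in> inner_core \<epsilon> V" using assms by (auto simp: inner_core_def)
  qed
  then have "ball x \<epsilon> \<subseteq> interior (inner_core \<epsilon> V)" by (rule interior_maximal) simp
  then show ?thesis using assms(1) by auto
qed

text \<open>Invariant measures violating the conclusion at scales tending to 0 would have a limit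
  violating \<open>less\<close>, since the neighbourhoods shrink to the closed \<open>K\<close> and
  the cores fill up the open \<open>V\<close>. With \<open>V\<close> empty, the constant
  \<open>c\<close> turns this into a way of thickening a closed set of small measure.\<close>

lemma uniform_margin:
  assumes K: "closed K" and V: "open V"
    and less: "\<And>\<mu>. invariant \<mu> \<Longrightarrow> measure \<mu> K < measure \<mu> V + c"
  obtains \<epsilon> where "0 < \<epsilon>"
    "\<And>\<mu>. invariant \<mu> \<Longrightarrow> measure \<mu> (outer_nbhd \<epsilon> K) < measure \<mu> (inner_core \<epsilon> V) + c"
proof (rule ccontr)
  assume "\<not> thesis"
  then have "\<forall>n. \<exists>\<mu>. invariant \<mu> \<and> measure \<mu> (inner_core (1 / real (Suc n)) V) + c
      \<le> measure \<mu> (outer_nbhd (1 / real (Suc n)) K)"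
    using that[of "1 / real (Suc n)" for n] by (simp add: not_less[symmetric]) blast
  from choice[OF this] obtain M where M: "\<And>n. invariant (M n)"
    and ge: "\<And>n. measure (M n) (inner_core (1 / real (Suc n)) V) + c
      \<le> measure (M n) (outer_nbhd (1 / real (Suc n)) K)"
    by auto
  obtain \<mu> where lim: "limit_measure (\<lambda>n. measure (M n)) \<mu>"
    using invariant_measure_limit[of M, OF M] by blast
  then have \<mu>: "invariant \<mu>" by (simp add: limit_measure_def)
  define e where "e j = 1 / real (Suc j)" for j
  have e_anti: "e n \<le> e j" if "j \<le> n" for j n
    using that by (auto simp: e_def field_simps)
  have e_pos: "0 < e j" for j by (simp add: e_def)
  \<comment> \<open>The interior is taken because the limit inequality needs an open set on its
    smaller side. The scale \<open>e j\<close> is held fixed while the measures run, and tends to 0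
    only afterwards.\<close>
  define W where "W j = interior (inner_core (e j) V)" for j
  define N where "N j = outer_nbhd (e j) K" for j
  have step: "measure \<mu> (W j) + c \<le> measure \<mu> (N j)" for j
  proof (rule limit_measureD[OF lim])
    show "closed (N j)" unfolding N_def by (rule closed_outer_nbhd[OF K])
    show "open (W j)" by (simp add: W_def)
    show "\<forall>\<^sub>F n in sequentially. measure (M n) (W j) + c \<le> measure (M n) (N j)"
    proof (rule eventually_sequentiallyI[of j])
      fix n assume n: "j \<le> n"
      interpret prob_space "M n" by (rule invariantD[OF M])
      have sets: "sets (M n) = sets borel" by (rule invariantD[OF M])
      have "measure (M n) (W j) \<le> measure (M n) (inner_core (e n) V)"
        using interior_subset inner_core_antimono[OF e_anti[OF n]]
        by (intro finite_measure_mono) (auto simp: sets W_def closed_inner_core)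
      moreover have "measure (M n) (outer_nbhd (e n) K) \<le> measure (M n) (N j)"
        using outer_nbhd_mono[OF e_anti[OF n]] K
        by (intro finite_measure_mono) (auto simp: sets N_def closed_outer_nbhd)
      ultimately show "measure (M n) (W j) + c \<le> measure (M n) (N j)"
        using ge[of n] by (simp add: e_def)
    qed
  qed
  interpret prob_space \<mu> by (rule invariantD[OF \<mu>])
  have sets: "sets \<mu> = sets borel" by (rule invariantD[OF \<mu>])
  have e_small: "\<exists>j. e j < d" if "0 < d" for d
    using reals_Archimedean[OF that] by (simp add: e_def inverse_eq_divide)
  have "incseq W"
    unfolding W_def by (intro incseq_SucI interior_mono inner_core_antimono e_anti) auto
  moreover have "(\<Union>j. W j) = V"
  proof
    show "(\<Union>j. W j) \<subseteq> V"
      using interior_subset inner_core_subset[OF e_pos] by (fastforce simp: W_def)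
    show "V \<subseteq> (\<Union>j. W j)"
    proof
      fix x assume "x \<in> V"
      then obtain r where r: "0 < r" "ball x r \<subseteq> V" using V open_contains_ball by blast
      obtain j where "e j < r / 2" using e_small[of "r / 2"] r by auto
      then have "ball x (2 * e j) \<subseteq> V" using r(2) by (auto simp: subset_ball)
      then have "x \<in> W j"
        unfolding W_def by (intro subset_inner_core_interior e_pos)
      then show "x \<in> (\<Union>j. W j)" by auto
    qed
  qed
  moreover have "range W \<subseteq> sets \<mu>" by (auto simp: sets W_def)
  ultimately have limW: "(\<lambda>j. measure \<mu> (W j)) \<longlonglongrightarrow> measure \<mu> V"
    using finite_Lim_measure_incseq[of W] by simp
  have "range N \<subseteq> sets \<mu>" using closed_outer_nbhd[OF K] by (auto simp: sets N_def)
  moreover have "decseq N"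
    unfolding N_def decseq_def by (intro allI impI outer_nbhd_mono e_anti)
  moreover have "(\<Inter>j. N j) = K"
  proof
    show "K \<subseteq> (\<Inter>j. N j)"
    proof
      fix x assume "x \<in> K"
      moreover have "dist x x \<le> e j" for j using e_pos[of j] by simp
      ultimately show "x \<in> (\<Inter>j. N j)" unfolding N_def outer_nbhd_def by blast
    qed
    show "(\<Inter>j. N j) \<subseteq> K"
    proof
      fix x assume x: "x \<in> (\<Inter>j. N j)"
      have "x \<in> closure K"
        unfolding closure_approachable
      proof (intro allI impI)
        fix d :: real assume "0 < d"
        then obtain j where "e j < d" using e_small by blast
        moreover obtain y where "y \<in> K" "dist x y \<le> e j"
          using x by (auto simp: N_def outer_nbhd_def)
        ultimately have "dist y x < d" by (simp add: dist_commute)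
        then show "\<exists>y\<in>K. dist y x < d" using \<open>y \<in> K\<close> by blast
      qed
      then show "x \<in> K" using K by simp
    qed
  qed
  ultimately have limN: "(\<lambda>j. measure \<mu> (N j)) \<longlonglongrightarrow> measure \<mu> K"
    using finite_Lim_measure_decseq[of N] by simp
  have "measure \<mu> V + c \<le> measure \<mu> K"
    by (rule LIMSEQ_le[OF tendsto_add[OF limW tendsto_const] limN]) (use step in auto)
  with less[OF \<mu>] show False by simp
qed

end

section \<open>The greedy matching\<close>

context compact_action begin

lemma act_modulus:
  assumes "g \<in> carrier G" "0 < e"
  obtains d where "0 < d" "\<And>x y. dist x y < d \<Longrightarrow> dist (act g x) (act g y) < e"
proof -
  have "uniformly_continuous_on UNIV (act g)"
    by (rule compact_uniformly_continuous[OF act_continuous[OF assms(1)] compact_UNIV])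
  then obtain d where "0 < d" "\<forall>x y. dist y x < d \<longrightarrow> dist (act g y) (act g x) < e"
    using assms(2) unfolding uniformly_continuous_on_def by auto
  then show thesis by (intro that[of d]) auto
qed

lemma act_common_modulus:
  assumes "finite F" "F \<subseteq> carrier G" "0 < e"
  obtains d where "0 < d" "\<And>g x y. g \<in> F \<Longrightarrow> dist x y < d \<Longrightarrow> dist (act g x) (act g y) < e"
proof -
  have "\<exists>d>0. \<forall>g\<in>F. \<forall>x y. dist x y < d \<longrightarrow> dist (act g x) (act g y) < e"
    using assms(1,2)
  proof (induction F rule: finite_induct)
    case empty
    then show ?case by (auto intro: zero_less_one)
  next
    case (insert h F)
    then obtain d where d: "0 < d" "\<forall>g\<in>F. \<forall>x y. dist x y < d \<longrightarrow> dist (act g x) (act g y) < e"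
      by auto
    obtain d' where d': "0 < d'" "\<And>x y. dist x y < d' \<Longrightarrow> dist (act h x) (act h y) < e"
      using act_modulus[of h e] insert.prems assms(3) by auto
    show ?case using d d' by (intro exI[of _ "min d d'"]) auto
  qed
  then show thesis using that by blast
qed

text \<open>Uniform continuity allows a choice in the order \<open>\<delta> 0\<close>,
  \<open>\<tau> 0\<close>, \<open>\<delta> 1\<close>, \<open>\<tau> 1\<close> and so on:
  \<open>\<delta> (Suc k)\<close> is adapted to \<open>g k\<close> and \<open>\<tau> k\<close>, and
  \<open>\<tau> (Suc k)\<close> to \<open>\<delta> k\<close> and the inverses of \<open>g 0\<close>
  up to \<open>g k\<close>.\<close>

lemma greedy_scales:
  fixes g :: "nat \<Rightarrow> 'a"
  assumes g: "\<And>i. g i \<in> carrier G" and \<kappa>: "0 < \<kappa>"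
  obtains \<delta> \<tau> :: "nat \<Rightarrow> real" where
    "\<And>k. 0 < \<delta> k" "\<And>k. 2 * \<delta> k \<le> \<kappa>" "\<And>k. \<tau> k \<le> \<kappa>"
    "\<And>k. 2 * \<delta> (Suc k) \<le> \<delta> k"
    "\<And>k x y. dist x y < 2 * \<delta> (Suc k) \<Longrightarrow> dist (act (g k) x) (act (g k) y) < \<tau> k"
    "\<And>k i x y. i \<le> k \<Longrightarrow> dist x y < \<tau> (Suc k) \<Longrightarrow>
      dist (act (inv (g i)) x) (act (inv (g i)) y) < \<delta> k"
proof -
  define P where "P p \<longleftrightarrow> 0 < fst p \<and> 2 * fst p \<le> \<kappa> \<and> 0 < snd p \<and> snd p \<le> \<kappa>" for p :: "real \<times> real"
  define Q where "Q k p q \<longleftrightarrow> 2 * fst q \<le> fst p \<and>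
      (\<forall>x y. dist x y < 2 * fst q \<longrightarrow> dist (act (g k) x) (act (g k) y) < snd p) \<and>
      (\<forall>i\<le>k. \<forall>x y. dist x y < snd q \<longrightarrow> dist (act (inv (g i)) x) (act (inv (g i)) y) < fst p)"
    for k and p q :: "real \<times> real"
  have base: "\<exists>p. P p" using \<kappa> by (intro exI[of _ "(\<kappa> / 2, \<kappa>)"]) (auto simp: P_def)
  have step: "\<exists>q. P q \<and> Q k p q" if p: "P p" for p k
  proof -
    obtain d where d: "0 < d" "\<And>x y. dist x y < d \<Longrightarrow> dist (act (g k) x) (act (g k) y) < snd p"
      using act_modulus[OF g[of k], of "snd p"] p unfolding P_def by blast
    obtain t where t: "0 < t"
      "\<And>h x y. h \<in> (\<lambda>i. inv (g i)) ` {..k} \<Longrightarrow> dist x y < t \<Longrightarrow> dist (act h x) (act h y) < fst p"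
      using act_common_modulus[of "(\<lambda>i. inv (g i)) ` {..k}" "fst p"] g p
      unfolding P_def by (metis (mono_tags, lifting) finite_atMost finite_imageI image_subsetI inv_closed)
    show ?thesis
      using p d t
      by (intro exI[of _ "(min (fst p / 2) (d / 2), min t \<kappa>)"]) (auto simp: P_def Q_def \<kappa>)
  qed
  obtain f where f: "\<And>k. P (f k)" "\<And>k. Q k (f k) (f (Suc k))"
    using dependent_nat_choice[of "\<lambda>_. P" Q] base step by metis
  show thesis
    using f unfolding P_def Q_def by (intro that[of "\<lambda>k. fst (f k)" "\<lambda>k. snd (f k)"]) blast+
qed

end

text \<open>The condition \<open>forward\<close> will prevent a point from being charged twice, and
  \<open>backward\<close> will charge the points of the target that are lost near the edge of an
  earlier removal.\<close>

locale greedy_matching = compact_action G act for G (structure) and act :: "'a \<Rightarrow> 'x::metric_space \<Rightarrow> 'x" +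
  fixes g :: "nat \<Rightarrow> 'a" and C B :: "'x set" and \<kappa> :: real and \<delta> \<tau> :: "nat \<Rightarrow> real"
  assumes g: "g i \<in> carrier G"
    and C: "closed C" and B: "open B" and \<kappa>: "0 < \<kappa>"
    and \<delta>_pos: "0 < \<delta> k" and \<delta>_le: "2 * \<delta> k \<le> \<kappa>"
    and \<tau>_le: "\<tau> k \<le> \<kappa>"
    and \<delta>_Suc: "2 * \<delta> (Suc k) \<le> \<delta> k"
    and forward: "dist x y < 2 * \<delta> (Suc k) \<Longrightarrow> dist (act (g k) x) (act (g k) y) < \<tau> k"
    and backward: "i \<le> k \<Longrightarrow> dist x y < \<tau> (Suc k) \<Longrightarrow>
      dist (act (inv (g i)) x) (act (inv (g i)) y) < \<delta> k"
begin

text \<open>The first component is the unmatched part of \<open>C\<close>, the second the free part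
  of \<open>B\<close>. Removing the preimage of an open set keeps the first one closed, and removing
  the image of a whole closed neighbourhood keeps the second one open.\<close>

primrec stage :: "nat \<Rightarrow> 'x set \<times> 'x set" where
  "stage 0 = (C, B)"
| "stage (Suc k) = (fst (stage k) - act (g k) -` snd (stage k),
    snd (stage k) - act (g k) ` outer_nbhd (\<delta> k) (fst (stage k)))"

definition rest :: "nat \<Rightarrow> 'x set" where "rest k = fst (stage k)"

definition room :: "nat \<Rightarrow> 'x set" where "room k = snd (stage k)"

definition piece :: "nat \<Rightarrow> 'x set" where
  "piece k = {x. \<exists>c\<in>rest k. dist x c < \<delta> k} \<inter> act (g k) -` room k"

text \<open>Two kinds of points pay: those within \<open>\<delta> k\<close> of the rest whose image
  has a free ball of radius \<open>\<tau> k\<close> around it, and those in the annulus between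
  \<open>\<delta> k\<close> and \<open>2 * \<delta> k\<close>. The second kind pays for losses along
  the edge of the removed set.\<close>

definition charged :: "nat \<Rightarrow> 'x set" where
  "charged k = {x. (\<exists>c\<in>rest k. dist x c < 2 * \<delta> k) \<and>
    ((\<exists>c\<in>rest k. dist x c \<le> \<delta> k) \<longrightarrow> ball (act (g k) x) (\<tau> k) \<subseteq> room k)}"

lemma rest_0: "rest 0 = C" and rest_Suc: "rest (Suc k) = rest k - act (g k) -` room k"
  and room_0: "room 0 = B"
  and room_Suc: "room (Suc k) = room k - act (g k) ` outer_nbhd (\<delta> k) (rest k)"
  by (simp_all add: rest_def room_def)

lemma closed_open_stage: "closed (rest k) \<and> open (room k)"
proof (induction k)
  case 0
  then show ?case using C B by (simp add: rest_0 room_0)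
next
  case (Suc k)
  then show ?case
    unfolding rest_Suc room_Suc
    by (auto intro!: closed_Diff open_Diff act_vimage_open act_image_closed closed_outer_nbhd g)
qed

lemma closed_rest: "closed (rest k)" and open_room: "open (room k)"
  using closed_open_stage by auto

lemma rest_antimono: "i \<le> j \<Longrightarrow> rest j \<subseteq> rest i"
  by (rule lift_Suc_antimono_le[of rest]) (auto simp: rest_Suc)

lemma room_antimono: "i \<le> j \<Longrightarrow> room j \<subseteq> room i"
  by (rule lift_Suc_antimono_le[of room]) (auto simp: room_Suc)

lemma \<delta>_antimono: "i \<le> j \<Longrightarrow> \<delta> j \<le> \<delta> i"
proof (rule lift_Suc_antimono_le[of \<delta>])
  show "\<delta> (Suc n) \<le> \<delta> n" for n
    using \<delta>_Suc[of n] \<delta>_pos[of "Suc n"] by simp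
qed

lemma open_nbhd: "open {x. \<exists>c\<in>K. dist x c < e}"
proof -
  have "{x. \<exists>c\<in>K. dist x c < e} = (\<Union>c\<in>K. ball c e)" by (auto simp: dist_commute)
  then show ?thesis by (metis open_UN open_ball)
qed

lemma open_piece: "open (piece k)"
  unfolding piece_def by (intro open_Int open_nbhd act_vimage_open g open_room)

lemma piece_image_room: "act (g k) ` piece k \<subseteq> room k"
  by (auto simp: piece_def)

lemma piece_image_removed: "act (g k) ` piece k \<inter> room (Suc k) = {}"
  by (auto simp: piece_def room_Suc outer_nbhd_def intro: less_imp_le)

lemma piece_image_disjoint:
  assumes "i \<noteq> j"
  shows "act (g i) ` piece i \<inter> act (g j) ` piece j = {}"
proof -
  have "act (g i) ` piece i \<inter> act (g j) ` piece j = {}" if "i < j" for i j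
    using piece_image_removed[of i] piece_image_room[of j] room_antimono[of "Suc i" j] that by auto
  then show ?thesis using assms by (metis Int_commute linorder_neqE_nat)
qed

lemma piece_cover: "C \<subseteq> (\<Union>k<n. piece k) \<union> rest n"
proof (induction n)
  case 0
  then show ?case by (simp add: rest_0)
next
  case (Suc n)
  have "rest n \<subseteq> piece n \<union> rest (Suc n)"
    using \<delta>_pos[of n] by (auto simp: piece_def rest_Suc intro!: bexI)
  then show ?case using Suc by (auto simp: lessThan_Suc)
qed

lemma charged_subset: "charged k \<subseteq> outer_nbhd \<kappa> C"
proof
  fix x assume "x \<in> charged k"
  then obtain c where c: "c \<in> rest k" "dist x c < 2 * \<delta> k" by (auto simp: charged_def)
  then have "c \<in> C" using rest_antimono[of 0 k] by (auto simp: rest_0)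
  then show "x \<in> outer_nbhd \<kappa> C" using c \<delta>_le[of k] by (force simp: outer_nbhd_def)
qed

text \<open>A point \<open>x\<close> charged at the later step \<open>j\<close> is close to some
  \<open>c\<close> in \<open>rest j\<close>, at a scale so small that step \<open>i\<close> sees
  them within \<open>\<delta> i\<close>. If \<open>x\<close> is charged at \<open>i\<close> too, the
  ball around its image was free, and by \<open>forward\<close> it contains
  \<open>act (g i) c\<close>; then \<open>c\<close> was matched at step \<open>i\<close> and cannot
  be left at step \<open>j\<close>.\<close>

lemma charged_disjoint:
  assumes "i < j"
  shows "charged i \<inter> charged j = {}"
proof (rule ccontr)
  assume "charged i \<inter> charged j \<noteq> {}"
  then obtain x where x: "x \<in> charged i" "x \<in> charged j" by blast
  obtain c where c: "c \<in> rest j" "dist x c < 2 * \<delta> j" using x(2) by (auto simp: charged_def)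
  have c_Suc: "c \<in> rest (Suc i)" using c(1) rest_antimono[of "Suc i" j] assms by auto
  have d: "dist x c < 2 * \<delta> (Suc i)" using c(2) \<delta>_antimono[of "Suc i" j] assms by simp
  then have "dist x c \<le> \<delta> i" using \<delta>_Suc[of i] by simp
  moreover have "c \<in> rest i" using c_Suc by (simp add: rest_Suc)
  ultimately have "ball (act (g i) x) (\<tau> i) \<subseteq> room i" using x(1) by (auto simp: charged_def)
  moreover have "act (g i) c \<in> ball (act (g i) x) (\<tau> i)" using forward[OF d] by simp
  ultimately show False using c_Suc by (auto simp: rest_Suc)
qed

lemma removed_at:
  assumes "y \<in> B" "y \<notin> room n"
  obtains k where "k < n" "y \<in> room k" "act (inv (g k)) y \<in> outer_nbhd (\<delta> k) (rest k)"
proof -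
  have "\<exists>k<n. y \<in> room k \<and> y \<notin> room (Suc k)"
    using assms
  proof (induction n)
    case 0
    then show ?case by (simp add: room_0)
  next
    case (Suc n)
    then show ?case by (metis lessI less_SucI)
  qed
  then show thesis using that g by (auto simp: room_Suc)
qed

text \<open>A removed point of the core is charged either to the point that used it, provided that its
  neighbourhood was still free, or to a point lying just outside an earlier neighbourhood of the rest.
  No point is charged twice: this is why the boundaries of the pieces, whose points remain unmatched,
  cost nothing.\<close>

lemma removed_charged:
  assumes y: "y \<in> inner_core \<kappa> B" "y \<notin> room n"
  shows "\<exists>i<n. act (inv (g i)) y \<in> charged i"
proof -
  have yB: "y \<in> B" using y(1) inner_core_subset[OF \<kappa>] by auto
  obtain k where k: "k < n" "y \<in> room k" "act (inv (g k)) y \<in> outer_nbhd (\<delta> k) (rest k)"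
    using removed_at[OF yB y(2)] by blast
  show ?thesis
  proof (cases "ball y (\<tau> k) \<subseteq> room k")
    case True
    obtain c where "c \<in> rest k" "dist (act (inv (g k)) y) c \<le> \<delta> k"
      using k(3) by (auto simp: outer_nbhd_def)
    then have "act (inv (g k)) y \<in> charged k"
      using True \<delta>_pos[of k] g by (auto simp: charged_def intro!: bexI[of _ c])
    then show ?thesis using k(1) by blast
  next
    \<comment> \<open>Some \<open>z\<close> near \<open>y\<close> was removed at an earlier step
      \<open>i\<close>. Applying the inverse of \<open>g i\<close> brings \<open>y\<close> close to
      the neighbourhood used at that step but not into it, because \<open>y\<close> was still free
      at the later step \<open>k\<close>.\<close>
    case False
    then obtain z where z: "dist y z < \<tau> k" "z \<notin> room k" by (auto simp: subset_iff)
    have "z \<in> B" using z(1) y(1) \<tau>_le[of k] by (auto simp: inner_core_def)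
    then obtain i where i: "i < k" "z \<in> room i" "act (inv (g i)) z \<in> outer_nbhd (\<delta> i) (rest i)"
      using removed_at z(2) by blast
    \<comment> \<open>With \<open>k = Suc l\<close>, the condition \<open>backward\<close> bounds
      the displacement by \<open>\<delta> l\<close>, and this is at most
      \<open>\<delta> i\<close>.\<close>
    obtain l where l: "k = Suc l" "i \<le> l" using i(1) by (metis less_Suc_eq_le less_imp_Suc_add)
    obtain c where c: "c \<in> rest i" "dist (act (inv (g i)) z) c \<le> \<delta> i"
      using i(3) by (auto simp: outer_nbhd_def)
    have "dist (act (inv (g i)) y) (act (inv (g i)) z) < \<delta> l"
      using backward[OF l(2), of y z] z(1) l(1) by simp
    then have "dist (act (inv (g i)) y) c < 2 * \<delta> i"
      using c(2) \<delta>_antimono[OF l(2)] dist_triangle[of "act (inv (g i)) y" c "act (inv (g i)) z"] by simp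
    moreover have "act (inv (g i)) y \<notin> outer_nbhd (\<delta> i) (rest i)"
    proof
      assume "act (inv (g i)) y \<in> outer_nbhd (\<delta> i) (rest i)"
      then have "act (g i) (act (inv (g i)) y) \<in> act (g i) ` outer_nbhd (\<delta> i) (rest i)" by blast
      then have "y \<notin> room (Suc i)" using g by (simp add: room_Suc)
      then show False using k(2) room_antimono[of "Suc i" k] i(1) by auto
    qed
    ultimately have "act (inv (g i)) y \<in> charged i"
      using c(1) by (auto simp: charged_def outer_nbhd_def)
    then show ?thesis using i(1) k(1) by (meson less_trans)
  qed
qed

lemma charged_borel: "charged k \<in> sets borel"
proof -
  have "charged k = {x. \<exists>c\<in>rest k. dist x c < 2 * \<delta> k} \<inter>
      (- outer_nbhd (\<delta> k) (rest k) \<union> act (g k) -` inner_core (\<tau> k) (room k))"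
    by (auto simp: charged_def outer_nbhd_def inner_core_def)
  moreover have "closed (act (g k) -` inner_core (\<tau> k) (room k))"
    by (intro act_vimage_closed g closed_inner_core)
  ultimately show ?thesis
    using closed_outer_nbhd[OF closed_rest, of "\<delta> k" k] open_nbhd[of "rest k" "2 * \<delta> k"]
    by (auto simp: borel_closed)
qed

section \<open>Consequences of the charging for invariant measures and for orbit counts\<close>

lemma unmatched_core_removed:
  assumes "x \<in> (\<Inter>k. rest k)"
  shows "act (g k) x \<notin> room k"
proof -
  have "x \<in> rest (Suc k)" using assms by blast
  then show ?thesis by (simp add: rest_Suc)
qed

text \<open>Mass transport: the removed points are covered by translates of the sets
  \<open>charged i\<close>; invariance brings the translates back without changing their measure,
  and the sets themselves are disjoint and lie near \<open>C\<close>.\<close>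

lemma removed_measure_le:
  assumes \<mu>: "invariant \<mu>" and A: "A \<in> sets borel"
    and removed: "A \<subseteq> inner_core \<kappa> B - (\<Inter>k. room k)"
  shows "measure \<mu> A \<le> measure \<mu> (outer_nbhd \<kappa> C)"
proof -
  interpret prob_space \<mu> by (rule invariantD[OF \<mu>])
  have sets: "sets \<mu> = sets borel" by (rule invariantD[OF \<mu>])
  define P where "P i = act (inv (g i)) -` charged i" for i
  have ig: "inv (g i) \<in> carrier G" for i using g by simp
  have P: "P i \<in> sets \<mu>" for i
    unfolding P_def sets by (intro act_vimage_borel ig charged_borel)
  have "A \<subseteq> (\<Union>i. P i)"
    using removed removed_charged unfolding P_def by fastforce
  then have "emeasure \<mu> A \<le> emeasure \<mu> (\<Union>i. P i)"
    using P by (intro emeasure_mono) auto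
  also have "\<dots> \<le> (\<Sum>i. emeasure \<mu> (P i))"
    using P by (intro emeasure_subadditive_countably) auto
  also have "\<dots> = (\<Sum>i. emeasure \<mu> (charged i))"
    unfolding P_def emeasure_eq_measure by (subst invariantD(4)[OF \<mu> ig charged_borel]) simp
  also have "\<dots> = emeasure \<mu> (\<Union>i. charged i)"
  proof (rule suminf_emeasure)
    show "range charged \<subseteq> sets \<mu>" using charged_borel sets by auto
    show "disjoint_family charged"
      unfolding disjoint_family_on_def by (metis Int_commute charged_disjoint linorder_neqE_nat)
  qed
  also have "\<dots> \<le> emeasure \<mu> (outer_nbhd \<kappa> C)"
    using charged_subset closed_outer_nbhd[OF C] by (intro emeasure_mono) (auto simp: sets)
  finally show ?thesis by (simp add: emeasure_eq_measure)
qed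

text \<open>If the unmatched set had positive measure, conditioning \<mu> on its saturation
  \<open>E\<close> would give an invariant measure \<nu>. Every point of \<open>E\<close> is the
  image under some \<open>g k\<close> of an unmatched point, hence outside \<open>room k\<close>. So
  \<nu>-almost all of the core is removed, and \<open>removed_measure_le\<close> contradicts the
  margin.\<close>

lemma unmatched_null:
  assumes margin: "\<And>\<mu>. invariant \<mu> \<Longrightarrow> measure \<mu> (outer_nbhd \<kappa> C) < measure \<mu> (inner_core \<kappa> B)"
    and range: "range g = carrier G" and \<mu>: "invariant \<mu>"
  shows "measure \<mu> (\<Inter>k. rest k) = 0"
proof (rule ccontr)
  interpret prob_space \<mu> by (rule invariantD[OF \<mu>])
  have sets: "sets \<mu> = sets borel" by (rule invariantD[OF \<mu>])
  let ?R = "\<Inter>k. rest k"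
  define E where "E = (\<Union>k. act (g k) ` ?R)"
  assume "measure \<mu> ?R \<noteq> 0"
  then have pos: "0 < measure \<mu> ?R" by (simp add: zero_less_measure_iff)
  have R: "closed ?R" using closed_rest by blast
  have E: "E \<in> sets borel"
    unfolding E_def by (intro sets.countable_UN) (auto intro!: borel_closed act_image_closed g R)
  have "?R \<subseteq> E"
  proof -
    obtain k where "g k = \<one>" using range by (metis imageE one_closed)
    then show ?thesis unfolding E_def by (intro UN_upper[of k, THEN order_trans[rotated]]) auto
  qed
  then have "measure \<mu> ?R \<le> measure \<mu> E"
    using E by (intro finite_measure_mono) (auto simp: sets)
  with pos have E_pos: "0 < measure \<mu> E" by simp
  then have E_nonnull: "emeasure \<mu> E \<noteq> 0" "emeasure \<mu> E \<noteq> \<infinity>" by (auto simp: emeasure_eq_measure)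
  have E_inv: "act h -` E = E" if h: "h \<in> carrier G" for h
  proof -
    have "act h x \<in> E" if x: "x \<in> E" and h: "h \<in> carrier G" for x h
    proof -
      obtain k z where z: "z \<in> ?R" "x = act (g k) z" using x by (auto simp: E_def)
      obtain l where "g l = h \<otimes> g k" using range h g by (metis imageE m_closed)
      then have "act h x = act (g l) z" using z h g by (simp add: act_mult)
      then show ?thesis using z by (auto simp: E_def)
    qed
    from this[of _ h] this[of _ "inv h"] show ?thesis
      using h by (auto) (metis act_inv(1) inv_closed)
  qed
  define \<nu> where "\<nu> = uniform_measure \<mu> E"
  have \<nu>: "measure \<nu> A = measure \<mu> (E \<inter> A) / measure \<mu> E" if "A \<in> sets borel" for A
    unfolding \<nu>_def using E_nonnull that by (intro measure_uniform_measure) (auto simp: sets)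
  have "invariant \<nu>"
    unfolding invariant_prob_measure_def
  proof (intro conjI ballI)
    show "prob_space \<nu>" unfolding \<nu>_def by (rule prob_space_uniform_measure) (fact E_nonnull)+
    show "sets \<nu> = sets borel" by (simp add: \<nu>_def sets)
    fix h A assume h: "h \<in> carrier G" and A: "A \<in> sets (borel :: 'x measure)"
    have "measure \<mu> (E \<inter> act h -` A) = measure \<mu> (act h -` (E \<inter> A))"
      using E_inv[OF h] by auto
    also have "\<dots> = measure \<mu> (E \<inter> A)" by (rule invariantD(4)[OF \<mu> h]) (use E A in auto)
    finally show "measure \<nu> (act h -` A) = measure \<nu> A"
      using \<nu> A act_vimage_borel[OF h A] by simp
  qed
  have core: "inner_core \<kappa> B \<in> sets borel" by (rule borel_closed[OF closed_inner_core])
  have "measure \<nu> (E \<inter> inner_core \<kappa> B) \<le> measure \<nu> (outer_nbhd \<kappa> C)"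
  proof (rule removed_measure_le)
    show "invariant \<nu>" by fact
    show "E \<inter> inner_core \<kappa> B \<in> sets borel" using E core by auto
    show "E \<inter> inner_core \<kappa> B \<subseteq> inner_core \<kappa> B - (\<Inter>k. room k)"
      using unmatched_core_removed by (fastforce simp: E_def)
  qed
  moreover have "measure \<nu> (E \<inter> inner_core \<kappa> B) = measure \<nu> (inner_core \<kappa> B)"
    using \<nu> E core by simp
  ultimately show False using margin[OF \<open>invariant \<nu>\<close>] by simp
qed

text \<open>Otherwise measures giving mass at least \<eta> to the decreasing closed sets
  \<open>rest n\<close> would have an invariant limit giving mass at least \<eta> to their
  intersection, which is null.\<close>

lemma unmatched_small:
  assumes margin: "\<And>\<mu>. invariant \<mu> \<Longrightarrow> measure \<mu> (outer_nbhd \<kappa> C) < measure \<mu> (inner_core \<kappa> B)"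
    and range: "range g = carrier G" and \<eta>: "0 < \<eta>"
  obtains n where "\<And>\<mu>. invariant \<mu> \<Longrightarrow> measure \<mu> (rest n) < \<eta>"
proof (rule ccontr)
  assume "\<not> thesis"
  then have "\<exists>\<mu>. invariant \<mu> \<and> \<eta> \<le> measure \<mu> (rest n)" for n
    using that by (meson not_less)
  then obtain M where M: "\<And>n. invariant (M n)" and ge: "\<And>n. \<eta> \<le> measure (M n) (rest n)"
    by metis
  obtain \<mu> where lim: "limit_measure (\<lambda>n. measure (M n)) \<mu>"
    using invariant_measure_limit[of M, OF M] by blast
  then have \<mu>: "invariant \<mu>" by (simp add: limit_measure_def)
  have "\<eta> \<le> measure \<mu> (rest j)" for j
  proof -
    have "\<eta> \<le> measure (M n) (rest j)" if "j \<le> n" for n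
    proof -
      interpret prob_space "M n" by (rule invariantD[OF M])
      have "measure (M n) (rest n) \<le> measure (M n) (rest j)"
        using rest_antimono[OF that] closed_rest invariantD(2)[OF M]
        by (intro finite_measure_mono) auto
      then show ?thesis using ge[of n] by simp
    qed
    \<comment> \<open>The empty set on the smaller side reduces the limit inequality to a lower
      bound for a closed set.\<close>
    then have "measure \<mu> {} + \<eta> \<le> measure \<mu> (rest j)"
      by (intro limit_measureD[OF lim] closed_rest eventually_sequentiallyI[of j]) auto
    then show ?thesis by simp
  qed
  moreover interpret prob_space \<mu> by (rule invariantD[OF \<mu>])
  have "(\<lambda>j. measure \<mu> (rest j)) \<longlonglongrightarrow> measure \<mu> (\<Inter>j. rest j)"
    using closed_rest rest_antimono invariantD(2)[OF \<mu>]
    by (intro finite_Lim_measure_decseq) (auto simp: decseq_def)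
  ultimately have "\<eta> \<le> measure \<mu> (\<Inter>j. rest j)"
    by (intro LIMSEQ_le_const) auto
  then show False using unmatched_null[OF margin range \<mu>] \<eta> by simp
qed

text \<open>The counting form of \<open>removed_measure_le\<close>, along the orbit of one unmatched
  point. Sending each point of the core to the point charged for it is injective: the charged sets
  are disjoint, so the charged point determines the step, and with it the group element that was
  applied.\<close>

lemma unmatched_card_le:
  assumes x: "x \<in> (\<Inter>k. rest k)" and F: "finite F" "F = g ` {..<n}"
  shows "card (inner_core \<kappa> B \<inter> (\<lambda>h. act h x) ` F)
    \<le> card (outer_nbhd \<kappa> C \<inter> (\<lambda>(f, h). act (inv f) (act h x)) ` (F \<times> F))"
proof -
  let ?Y = "inner_core \<kappa> B \<inter> (\<lambda>h. act h x) ` F"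
  have "\<exists>i<n. act (inv (g i)) y \<in> charged i" if y: "y \<in> ?Y" for y
  proof -
    obtain k where k: "k < n" "y = act (g k) x" using y F by auto
    then have "y \<notin> room k" using unmatched_core_removed[OF x] by simp
    then show ?thesis using removed_charged[of y k] y k by (metis IntD1 less_trans)
  qed
  then obtain i where i: "\<And>y. y \<in> ?Y \<Longrightarrow> i y < n \<and> act (inv (g (i y))) y \<in> charged (i y)"
    by metis
  let ?f = "\<lambda>y. act (inv (g (i y))) y"
  have "inj_on ?f ?Y"
  proof (rule inj_onI)
    fix y z assume yz: "y \<in> ?Y" "z \<in> ?Y" "?f y = ?f z"
    have "?f y \<in> charged (i y) \<inter> charged (i z)" using i[OF yz(1)] i[OF yz(2)] yz(3) by simp
    then have "i y = i z"
      using charged_disjoint[of "i y" "i z"] charged_disjoint[of "i z" "i y"]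
      by (metis Int_commute empty_iff linorder_neqE_nat)
    then show "y = z" using yz(3) g by (metis act_inv(2))
  qed
  moreover have "?f ` ?Y \<subseteq> outer_nbhd \<kappa> C \<inter> (\<lambda>(f, h). act (inv f) (act h x)) ` (F \<times> F)"
  proof (intro subsetI IntI)
    fix z assume "z \<in> ?f ` ?Y"
    then obtain y where y: "y \<in> ?Y" "z = ?f y" by blast
    show "z \<in> outer_nbhd \<kappa> C" using i[OF y(1)] y(2) charged_subset by auto
    obtain h where "h \<in> F" "y = act h x" using y by auto
    moreover have "g (i y) \<in> F" using i[OF y(1)] F by auto
    ultimately show "z \<in> (\<lambda>(f, h). act (inv f) (act h x)) ` (F \<times> F)"
      using y(2) by (auto intro!: image_eqI[of _ _ "(g (i y), h)"])
  qed
  ultimately show ?thesis using F by (intro card_inj_on_le) auto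
qed

end

section \<open>Orbits of groups of polynomial growth\<close>

context group begin

lemma foldr_mult_closed: "set l \<subseteq> carrier G \<Longrightarrow> foldr (\<otimes>) l \<one> \<in> carrier G"
  by (induction l) auto

lemma foldr_mult_append:
  assumes "set l \<subseteq> carrier G" "set l' \<subseteq> carrier G"
  shows "foldr (\<otimes>) (l @ l') \<one> = foldr (\<otimes>) l \<one> \<otimes> foldr (\<otimes>) l' \<one>"
  using assms by (induction l) (auto simp: foldr_mult_closed m_assoc)

lemma foldr_mult_inv:
  assumes "set l \<subseteq> carrier G"
  shows "inv (foldr (\<otimes>) l \<one>) = foldr (\<otimes>) (rev (map (\<lambda>s. inv s) l)) \<one>"
  using assms
proof (induction l)
  case (Cons a l)
  have "foldr (\<otimes>) (rev (map (\<lambda>s. inv s) l) @ [inv a]) \<one>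
      = foldr (\<otimes>) (rev (map (\<lambda>s. inv s) l)) \<one> \<otimes> foldr (\<otimes>) [inv a] \<one>"
    using Cons.prems by (intro foldr_mult_append) auto
  then show ?case using Cons by (simp add: inv_mult_group foldr_mult_closed)
qed simp

context
  fixes S assumes S: "S \<subseteq> carrier G"
begin

lemma finite_word_ball:
  assumes "finite S"
  shows "finite (word_ball G S n)"
proof -
  have "word_ball G S n = (\<lambda>l. foldr (\<otimes>) l \<one>) ` {l. set l \<subseteq> S \<and> length l \<le> n}"
    by (auto simp: word_ball_def)
  then show ?thesis using finite_lists_length_le[OF assms] by simp
qed

lemma one_word_ball: "\<one> \<in> word_ball G S n"
  by (auto simp: word_ball_def intro!: exI[of _ "[]"])

lemma word_ball_mult:
  assumes "a \<in> word_ball G S m" "b \<in> word_ball G S n"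
  shows "a \<otimes> b \<in> word_ball G S (m + n)"
proof -
  obtain l l' where l: "a = foldr (\<otimes>) l \<one>" "set l \<subseteq> S" "length l \<le> m"
    and l': "b = foldr (\<otimes>) l' \<one>" "set l' \<subseteq> S" "length l' \<le> n"
    using assms by (auto simp: word_ball_def)
  have "a \<otimes> b = foldr (\<otimes>) (l @ l') \<one>"
    using foldr_mult_append[of l l'] l l' S by auto
  then show ?thesis using l l' unfolding word_ball_def by (intro CollectI exI[of _ "l @ l'"]) auto
qed

lemma word_ball_inv:
  assumes "\<And>s. s \<in> S \<Longrightarrow> inv s \<in> S" "a \<in> word_ball G S n"
  shows "inv a \<in> word_ball G S n"
proof -
  obtain l where l: "a = foldr (\<otimes>) l \<one>" "set l \<subseteq> S" "length l \<le> n"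
    using assms(2) by (auto simp: word_ball_def)
  have "inv a = foldr (\<otimes>) (rev (map (\<lambda>s. inv s) l)) \<one>"
    using foldr_mult_inv[of l] l S by auto
  then show ?thesis
    using l assms(1) unfolding word_ball_def
    by (intro CollectI exI[of _ "rev (map (\<lambda>s. inv s) l)"]) auto
qed

lemma word_balls_exhaust:
  assumes "\<And>s. s \<in> S \<Longrightarrow> inv s \<in> S"
  shows "(\<Union>n. word_ball G S n) = generate G S"
proof
  have "foldr (\<otimes>) l \<one> \<in> generate G S" if "set l \<subseteq> S" for l
    using that by (induction l) (auto intro: generate.intros)
  then show "(\<Union>n. word_ball G S n) \<subseteq> generate G S" by (auto simp: word_ball_def)
  have gen: "s \<in> word_ball G S 1" if "s \<in> S" for s
    using that S unfolding word_ball_def by (intro CollectI exI[of _ "[s]"]) auto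
  show "generate G S \<subseteq> (\<Union>n. word_ball G S n)"
  proof
    fix h assume "h \<in> generate G S"
    then show "h \<in> (\<Union>n. word_ball G S n)"
    proof induction
      case one
      then show ?case using one_word_ball by blast
    next
      case (incl h)
      then show ?case using gen by blast
    next
      case (inv h)
      then show ?case using gen assms by blast
    next
      case (eng h1 h2)
      then show ?case using word_ball_mult by blast
    qed
  qed
qed

end

end

section \<open>Enumeration along growing finite sets, and the choice of good radii\<close>

lemma exhausting_enumeration:
  fixes F :: "nat \<Rightarrow> 'b set"
  assumes fin: "\<And>n. finite (F n)" and ne: "\<And>n. F n \<noteq> {}" and mono: "\<And>n. F n \<subseteq> F (Suc n)"
  obtains g :: "nat \<Rightarrow> 'b" and N :: "nat \<Rightarrow> nat"
  where "\<And>n. g ` {..<N n} = F n" "range g = (\<Union>n. F n)"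
proof -
  obtain xs where xs: "\<And>n. set (xs n) = F n" using finite_list[OF fin] by metis
  \<comment> \<open>\<open>L n\<close> lists \<open>F 0\<close> up to \<open>F n\<close> one after
    the other. The repetitions keep the enumeration infinite even when the union is finite.\<close>
  define L where "L = rec_nat (xs 0) (\<lambda>n l. l @ xs (Suc n))"
  have L: "L 0 = xs 0" "L (Suc n) = L n @ xs (Suc n)" for n by (simp_all add: L_def)
  have set_L: "set (L n) = F n" for n
    by (induction n) (simp_all add: L xs Un_absorb1[OF mono])
  have len: "n < length (L n)" for n
  proof (induction n)
    case 0
    then show ?case using xs[of 0] ne[of 0] by (auto simp: L)
  next
    case (Suc n)
    have "0 < length (xs (Suc n))" using xs[of "Suc n"] ne[of "Suc n"] by auto
    then show ?case using Suc by (simp only: L length_append)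
  qed
  have prefix: "i < length (L m) \<and> L n ! i = L m ! i" if "i < length (L m)" "m \<le> n" for i m n
  proof -
    have "\<exists>l. L n = L m @ l"
      using that(2) by (induction n rule: dec_induct) (auto simp: L)
    then show ?thesis using that(1) by (auto simp: nth_append)
  qed
  \<comment> \<open>The entry exists because no \<open>F n\<close> is empty, so that
    \<open>L i\<close> has more than \<open>i\<close> entries; by \<open>prefix\<close>, every list
    that is long enough has the same entry there.\<close>
  define g where "g i = L i ! i" for i
  have "g i = L n ! i" if "i < length (L n)" for i n
    using prefix[of i n i] prefix[of i i n] that len[of i] unfolding g_def by (metis nle_le)
  then have img: "g ` {..<length (L n)} = F n" for n
    unfolding set_L[symmetric] set_conv_nth by force
  moreover have "range g = (\<Union>n. F n)"
  proof
    show "range g \<subseteq> (\<Union>n. F n)" using img len by blast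
    show "(\<Union>n. F n) \<subseteq> range g" using img by blast
  qed
  ultimately show thesis by (rule that)
qed

text \<open>Otherwise every multiplication of the radius by 8 from \<open>N0\<close> on multiplies
  \<open>v\<close> by more than \<open>2 * 8 ^ p\<close>, whereas \<open>growth\<close> permits only
  a factor \<open>8 ^ p\<close> on average. The spare factor 2 yields the contradiction.\<close>

lemma doubling_scale:
  fixes v :: "nat \<Rightarrow> nat" and K :: real
  assumes mono: "\<And>m n. m \<le> n \<Longrightarrow> v m \<le> v n" and pos: "\<And>n. 1 \<le> v n"
    and growth: "\<And>n. 1 \<le> n \<Longrightarrow> real (v n) \<le> K * real n ^ p"
  shows "\<exists>N\<ge>N0. v (8 * N) \<le> 2 * 8 ^ p * v N"
proof (rule ccontr)
  assume "\<not> ?thesis"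
  then have grow: "2 * 8 ^ p * v N < v (8 * N)" if "N0 \<le> N" for N
    using that by (meson not_less)
  \<comment> \<open>The starting radius must be at least \<open>N0\<close> for \<open>grow\<close>
    and positive for \<open>growth\<close>.\<close>
  define M where "M = max N0 1"
  have "(2 * 8 ^ p) ^ i \<le> v (8 ^ i * M)" for i
  proof (induction i)
    case 0
    then show ?case using pos by simp
  next
    case (Suc i)
    have "N0 \<le> 8 ^ i * M"
      using mult_le_mono1[of 1 "8 ^ i" M] by (simp add: M_def)
    then have "2 * 8 ^ p * v (8 ^ i * M) < v (8 * (8 ^ i * M))" by (rule grow)
    moreover have "2 * 8 ^ p * (2 * 8 ^ p) ^ i \<le> 2 * 8 ^ p * v (8 ^ i * M)"
      using Suc by simp
    ultimately have "2 * 8 ^ p * (2 * 8 ^ p) ^ i \<le> v (8 * (8 ^ i * M))"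
      by (meson le_less_trans less_imp_le)
    then show ?case by (simp only: power_Suc mult.assoc)
  qed
  moreover have "real (v (8 ^ i * M)) \<le> K * real (8 ^ i * M) ^ p" for i
  proof (rule growth)
    have "0 < 8 ^ i * M" by (simp add: M_def)
    then show "1 \<le> 8 ^ i * M" by linarith
  qed
  ultimately have "real ((2 * 8 ^ p) ^ i) \<le> K * real (8 ^ i * M) ^ p" for i
    by (meson of_nat_mono order_trans)
  then have "2 ^ i * (8 ^ p) ^ i \<le> (K * real M ^ p) * (8 ^ p) ^ i" for i
    by (simp add: power_mult_distrib mult.commute mult.left_commute flip: power_mult)
  then have bound: "2 ^ i \<le> K * real M ^ p" for i by simp
  obtain i where "K * real M ^ p < 2 ^ i" using real_arch_pow[of 2] by auto
  then show False using bound[of i] by simp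
qed

text \<open>Between the radii \<open>4 * N\<close> and \<open>6 * N\<close> there is room for
  \<open>I\<close> increments of length \<open>2 * k\<close>. If each multiplied \<open>v\<close> by
  more than \<open>1 + \<epsilon>\<close>, then \<open>v\<close> would grow from \<open>N\<close> to
  \<open>8 * N\<close> by more than \<open>2 * 8 ^ p\<close>. A good increment also inherits the
  doubling bound from \<open>N\<close> and \<open>8 * N\<close>.\<close>

lemma folner_scale:
  fixes v :: "nat \<Rightarrow> nat" and K \<epsilon> :: real
  assumes mono: "\<And>m n. m \<le> n \<Longrightarrow> v m \<le> v n" and pos: "\<And>n. 1 \<le> v n"
    and growth: "\<And>n. 1 \<le> n \<Longrightarrow> real (v n) \<le> K * real n ^ p" and \<epsilon>: "0 < \<epsilon>"
  obtains n where "R \<le> n" "real (v (2 * n + k)) \<le> (1 + \<epsilon>) * real (v (2 * n))"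
    "v (2 * n) \<le> 2 * 8 ^ p * v (n - R)"
proof -
  obtain I where I: "2 * 8 ^ p < (1 + \<epsilon>) ^ I"
    using real_arch_pow[of "1 + \<epsilon>"] \<epsilon> by auto
  obtain N where N: "R + k * I \<le> N" "v (8 * N) \<le> 2 * 8 ^ p * v N"
    using doubling_scale[of v K p "R + k * I", OF mono pos growth] by blast
  \<comment> \<open>The radii are even because they must have the form \<open>2 * n\<close>. They
    stay below \<open>8 * N\<close> since \<open>k * i \<le> N\<close>, and half of each, less
    \<open>R\<close>, is still at least \<open>N\<close>.\<close>
  define m where "m i = 4 * N + 2 * k * i" for i
  have kI: "k * i \<le> N" if "i \<le> I" for i
    using N(1) mult_le_mono2[OF that, of k] by linarith
  have "\<exists>i<I. real (v (m i + 2 * k)) \<le> (1 + \<epsilon>) * real (v (m i))"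
  proof (rule ccontr)
    assume "\<not> ?thesis"
    then have grow: "(1 + \<epsilon>) * real (v (m i)) < real (v (m (Suc i)))" if "i < I" for i
      using that by (auto simp: m_def not_le algebra_simps)
    have "(1 + \<epsilon>) ^ i * real (v N) \<le> real (v (m i))" if "i \<le> I" for i
      using that
    proof (induction i)
      case 0
      then show ?case using mono[of N "m 0"] by (simp add: m_def)
    next
      case (Suc i)
      then have "(1 + \<epsilon>) * ((1 + \<epsilon>) ^ i * real (v N)) \<le> (1 + \<epsilon>) * real (v (m i))"
        using \<epsilon> by (intro mult_left_mono) auto
      then show ?case using grow[of i] Suc.prems by (simp add: mult.assoc)
    qed
    from this[of I] have "(1 + \<epsilon>) ^ I * real (v N) \<le> real (v (m I))" by simp
    also have "\<dots> \<le> real (v (8 * N))"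
    proof (intro of_nat_mono mono)
      show "m I \<le> 8 * N" unfolding m_def using kI[of I] by linarith
    qed
    also have "\<dots> \<le> 2 * 8 ^ p * real (v N)"
      using of_nat_mono[OF N(2), where 'a = real] by simp
    finally show False using I pos[of N] by simp
  qed
  then obtain i where i: "i < I" "real (v (m i + 2 * k)) \<le> (1 + \<epsilon>) * real (v (m i))" by blast
  define n where "n = 2 * N + k * i"
  have m: "m i = 2 * n" by (simp add: m_def n_def)
  show thesis
  proof (rule that[of n])
    show "R \<le> n" using N(1) by (simp add: n_def)
    have "real (v (2 * n + k)) \<le> real (v (m i + 2 * k))" using mono m by simp
    then show "real (v (2 * n + k)) \<le> (1 + \<epsilon>) * real (v (2 * n))" using i(2) m by simp
    have "2 * n \<le> 2 * (2 * N + N)"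
      unfolding n_def by (intro mult_le_mono2 add_left_mono kI less_imp_le i(1))
    then have "2 * n \<le> 8 * N" by simp
    then have "v (2 * n) \<le> v (8 * N)" by (rule mono)
    also have "\<dots> \<le> 2 * 8 ^ p * v N" by (rule N)
    also have "\<dots> \<le> 2 * 8 ^ p * v (n - R)"
      using N(1) by (intro mult_le_mono mono) (auto simp: n_def)
    finally show "v (2 * n) \<le> 2 * 8 ^ p * v (n - R)" .
  qed
qed

section \<open>Balls in orbits and the invariant limits of their counting measures\<close>

locale polynomial_action = compact_action G act
  for G (structure) and act :: "'a \<Rightarrow> 'x::metric_space \<Rightarrow> 'x" +
  fixes F :: "nat \<Rightarrow> 'a set" and K :: real and p :: nat
  assumes F_finite: "finite (F n)"
    and F_one: "\<one> \<in> F n"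
    and F_mult: "a \<in> F m \<Longrightarrow> b \<in> F n \<Longrightarrow> a \<otimes> b \<in> F (m + n)"
    and F_inv: "a \<in> F n \<Longrightarrow> inv a \<in> F n"
    and F_exhaust: "(\<Union>n. F n) = carrier G"
    and F_card: "1 \<le> n \<Longrightarrow> real (card (F n)) \<le> K * real n ^ p"
begin

lemma F_carrier: "a \<in> F n \<Longrightarrow> a \<in> carrier G"
  using F_exhaust by blast

lemma F_mono: "m \<le> n \<Longrightarrow> F m \<subseteq> F n"
  using F_mult[of _ m \<one> "n - m"] F_one F_carrier by fastforce

text \<open>Points are counted rather than group elements, because the charging is an injection of
  points into points; different group elements may give the same point.\<close>

definition orbit_ball :: "nat \<Rightarrow> 'x \<Rightarrow> 'x set" where
  "orbit_ball n x = (\<lambda>h. act h x) ` F n"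

lemma finite_orbit_ball [simp]: "finite (orbit_ball n x)"
  by (simp add: orbit_ball_def F_finite)

lemma orbit_ball_mono: "m \<le> n \<Longrightarrow> orbit_ball m x \<subseteq> orbit_ball n x"
  using F_mono by (auto simp: orbit_ball_def)

lemma act_orbit_ball:
  assumes "h \<in> F m" "z \<in> orbit_ball n x"
  shows "act h z \<in> orbit_ball (m + n) x"
proof -
  obtain k where k: "k \<in> F n" "z = act k x" using assms(2) by (auto simp: orbit_ball_def)
  then have "act h z = act (h \<otimes> k) x" using assms(1) by (simp add: act_mult F_carrier)
  then show ?thesis using F_mult[OF assms(1) k(1)] by (auto simp: orbit_ball_def)
qed

lemma card_orbit_ball_pos: "1 \<le> card (orbit_ball n x)"
proof -
  have "orbit_ball n x \<noteq> {}" using F_one by (auto simp: orbit_ball_def)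
  then show ?thesis by (simp add: Suc_leI card_gt_0_iff)
qed

lemma orbit_folner:
  assumes "0 < \<epsilon>"
  obtains n where "R \<le> n"
    "real (card (orbit_ball (2 * n + k) x)) \<le> (1 + \<epsilon>) * real (card (orbit_ball (2 * n) x))"
    "card (orbit_ball (2 * n) x) \<le> 2 * 8 ^ p * card (orbit_ball (n - R) x)"
proof (rule folner_scale[of "\<lambda>n. card (orbit_ball n x)" K p \<epsilon> R k])
  show "card (orbit_ball m x) \<le> card (orbit_ball n x)" if "m \<le> n" for m n
    using that by (intro card_mono orbit_ball_mono) auto
  show "real (card (orbit_ball n x)) \<le> K * real n ^ p" if "1 \<le> n" for n
    using F_card[OF that] card_image_le[OF F_finite, of "\<lambda>h. act h x" n]
    by (simp add: orbit_ball_def)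
qed (use assms card_orbit_ball_pos that in auto)

definition frequency :: "nat \<Rightarrow> 'x \<Rightarrow> 'x set \<Rightarrow> real" where
  "frequency n x A = real (card (A \<inter> orbit_ball n x)) / real (card (orbit_ball n x))"

text \<open>The ball and its image under \<open>act h\<close> have equally many points and both lie
  in the ball of radius \<open>n + k\<close>, so neither has more points outside the other than
  there are between the two radii.\<close>

lemma frequency_shift:
  assumes "h \<in> F k"
  shows "\<bar>frequency n x (act h -` A) - frequency n x A\<bar>
    \<le> (real (card (orbit_ball (n + k) x)) - real (card (orbit_ball n x))) / real (card (orbit_ball n x))"
proof -
  let ?E = "orbit_ball n x"
  let ?hE = "act h ` ?E"
  have h: "h \<in> carrier G" using assms F_carrier by blast
  have inj: "inj_on (act h) S" for S using inj_act[OF h] by (rule inj_on_subset) simp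
  have sub: "?E \<subseteq> orbit_ball (n + k) x" by (rule orbit_ball_mono) simp
  have "?hE \<subseteq> orbit_ball (n + k) x"
    using act_orbit_ball[OF assms, of _ n x] by (auto simp: add.commute[of k n])
  then have "card (?hE - ?E) \<le> card (orbit_ball (n + k) x - ?E)" by (intro card_mono) auto
  also have "\<dots> = card (orbit_ball (n + k) x) - card ?E" using sub by (intro card_Diff_subset) auto
  finally have out: "real (card (?hE - ?E)) \<le> real (card (orbit_ball (n + k) x)) - real (card ?E)"
    using card_mono[OF _ sub] by simp
  have eq: "card (?E - ?hE) = card (?hE - ?E)"
    using card_le_sym_Diff[of ?E ?hE] card_le_sym_Diff[of ?hE ?E] by (simp add: card_image inj)
  have pre: "card (act h -` A \<inter> ?E) = card (A \<inter> ?hE)"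
  proof -
    have "act h ` (act h -` A \<inter> ?E) = A \<inter> ?hE" by auto
    then show ?thesis using card_image[OF inj] by metis
  qed
  have "card (A \<inter> ?hE) \<le> card ((A \<inter> ?E) \<union> (?hE - ?E))" by (intro card_mono) auto
  also have "\<dots> \<le> card (A \<inter> ?E) + card (?hE - ?E)" by (rule card_Un_le)
  finally have 1: "card (A \<inter> ?hE) \<le> card (A \<inter> ?E) + card (?hE - ?E)" .
  have "card (A \<inter> ?E) \<le> card ((A \<inter> ?hE) \<union> (?E - ?hE))" by (intro card_mono) auto
  also have "\<dots> \<le> card (A \<inter> ?hE) + card (?E - ?hE)" by (rule card_Un_le)
  finally have 2: "card (A \<inter> ?E) \<le> card (A \<inter> ?hE) + card (?hE - ?E)" using eq by simp
  have "\<bar>real (card (act h -` A \<inter> ?E)) - real (card (A \<inter> ?E))\<bar>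
      \<le> real (card (orbit_ball (n + k) x)) - real (card ?E)"
    using 1 2 out pre by linarith
  then show ?thesis
    unfolding frequency_def diff_divide_distrib[symmetric] abs_divide
    by (simp add: divide_right_mono)
qed

text \<open>The radii are Folner with error \<open>1 / real (Suc j)\<close> for translations from
  \<open>F j\<close>. Any fixed group element lies in \<open>F j\<close> eventually, so the
  frequencies become invariant. The doubling bound is carried along for the count in
  \<open>small_matches\<close>.\<close>

lemma orbit_limit:
  obtains \<mu> and n :: "nat \<Rightarrow> nat" where "limit_measure (\<lambda>j. frequency (2 * n j) x) \<mu>"
    "\<And>j. R \<le> n j"
    "\<And>j. card (orbit_ball (2 * n j) x) \<le> 2 * 8 ^ p * card (orbit_ball (n j - R) x)"
proof -
  have "\<exists>n\<ge>R. real (card (orbit_ball (2 * n + j) x)) \<le>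
        (1 + 1 / real (Suc j)) * real (card (orbit_ball (2 * n) x)) \<and>
      card (orbit_ball (2 * n) x) \<le> 2 * 8 ^ p * card (orbit_ball (n - R) x)" for j
    using orbit_folner[of "1 / real (Suc j)" R j x] by (metis of_nat_0_less_iff zero_less_Suc zero_less_divide_1_iff)
  then obtain n where n: "\<And>j. R \<le> n j"
    "\<And>j. real (card (orbit_ball (2 * n j + j) x)) \<le>
      (1 + 1 / real (Suc j)) * real (card (orbit_ball (2 * n j) x))"
    "\<And>j. card (orbit_ball (2 * n j) x) \<le> 2 * 8 ^ p * card (orbit_ball (n j - R) x)"
    by metis
  have pos: "0 < card (orbit_ball m x)" for m using card_orbit_ball_pos[of m x] by simp
  have le: "frequency m x A \<le> 1" for m A
    using pos[of m] card_mono[of "orbit_ball m x" "A \<inter> orbit_ball m x"]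
    by (auto simp: frequency_def divide_le_eq_1)
  obtain \<mu> where "limit_measure (\<lambda>j. frequency (2 * n j) x) \<mu>"
  proof (rule invariant_limit[of "\<lambda>j. frequency (2 * n j) x"])
    show "0 \<le> frequency (2 * n j) x A" "frequency (2 * n j) x A \<le> 1" for j A
      using le by (auto simp: frequency_def)
    show "frequency (2 * n j) x UNIV = 1" for j
      using pos[of "2 * n j"] by (auto simp: frequency_def)
    show "frequency (2 * n j) x (A \<union> B) = frequency (2 * n j) x A + frequency (2 * n j) x B"
      if "A \<inter> B = {}" for j A B
    proof -
      have "card ((A \<union> B) \<inter> orbit_ball (2 * n j) x) =
          card (A \<inter> orbit_ball (2 * n j) x) + card (B \<inter> orbit_ball (2 * n j) x)"
        unfolding Int_Un_distrib2 using that by (intro card_Un_disjoint) auto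
      then show ?thesis by (simp add: frequency_def add_divide_distrib)
    qed
    show "(\<lambda>j. frequency (2 * n j) x (act h -` A) - frequency (2 * n j) x A) \<longlonglongrightarrow> 0"
      if "h \<in> carrier G" for h A
    proof -
      obtain k where k: "h \<in> F k" using \<open>h \<in> carrier G\<close> F_exhaust by blast
      have bound: "\<bar>frequency (2 * n j) x (act h -` A) - frequency (2 * n j) x A\<bar> \<le> 1 / real (Suc j)"
        if "k \<le> j" for j
      proof -
        have "h \<in> F j" using k F_mono[OF that] by auto
        then have "\<bar>frequency (2 * n j) x (act h -` A) - frequency (2 * n j) x A\<bar>
          \<le> (real (card (orbit_ball (2 * n j + j) x)) - real (card (orbit_ball (2 * n j) x)))
            / real (card (orbit_ball (2 * n j) x))"
          by (rule frequency_shift)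
        also have "\<dots> \<le> 1 / real (Suc j)"
          using n(2)[of j] pos[of "2 * n j"] by (simp add: divide_le_eq algebra_simps)
        finally show ?thesis .
      qed
      show ?thesis
      proof (rule Lim_null_comparison)
        show "\<forall>\<^sub>F j in sequentially. norm (frequency (2 * n j) x (act h -` A) - frequency (2 * n j) x A)
            \<le> 1 / real (Suc j)"
          using bound by (intro eventually_sequentiallyI[of k]) auto
        show "(\<lambda>j. 1 / real (Suc j)) \<longlonglongrightarrow> 0"
          using LIMSEQ_inverse_real_of_nat by (simp add: inverse_eq_divide)
      qed
    qed
  qed
  then show thesis using n by (intro that[of n \<mu>])
qed

end

section \<open>Comparison\<close>

context compact_action begin

text \<open>The condition of \<open>subequivalent\<close> for a single set \<open>C\<close>,
  isolated so that partial matchings can be put together.\<close>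

definition matches :: "'x set \<Rightarrow> 'x set \<Rightarrow> bool" where
  "matches C B \<longleftrightarrow> (\<exists>n::nat. \<exists>U s. (\<forall>i<n. open (U i) \<and> s i \<in> carrier G \<and> act (s i) ` U i \<subseteq> B) \<and>
    C \<subseteq> (\<Union>i<n. U i) \<and>
    (\<forall>i<n. \<forall>j<n. i \<noteq> j \<longrightarrow> act (s i) ` U i \<inter> act (s j) ` U j = {}))"

lemma subequivalent_iff: "subequivalent G act A B \<longleftrightarrow> (\<forall>C. closed C \<and> C \<subseteq> A \<longrightarrow> matches C B)"
  by (simp add: subequivalent_def matches_def)

lemma matchesE:
  assumes "matches C B"
  obtains n :: nat and U s where
    "\<forall>i<n. open (U i) \<and> s i \<in> carrier G \<and> act (s i) ` U i \<subseteq> B" "C \<subseteq> (\<Union>i<n. U i)"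
    "\<forall>i<n. \<forall>j<n. i \<noteq> j \<longrightarrow> act (s i) ` U i \<inter> act (s j) ` U j = {}"
  using assms unfolding matches_def by (elim exE conjE) (rule that)

lemma matches_mono:
  assumes "matches C B" "C' \<subseteq> C" "B \<subseteq> B'"
  shows "matches C' B'"
proof (rule matchesE[OF assms(1)])
  fix n :: nat and U s
  assume "\<forall>i<n. open (U i) \<and> s i \<in> carrier G \<and> act (s i) ` U i \<subseteq> B" "C \<subseteq> (\<Union>i<n. U i)"
    "\<forall>i<n. \<forall>j<n. i \<noteq> j \<longrightarrow> act (s i) ` U i \<inter> act (s j) ` U j = {}"
  with assms(2,3) show ?thesis
    unfolding matches_def by (intro exI[of _ n] exI[of _ U] exI[of _ s] conjI) blast+
qed

lemma matches_Un:
  assumes "matches C1 B1" "matches C2 B2" "B1 \<inter> B2 = {}"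
  shows "matches (C1 \<union> C2) (B1 \<union> B2)"
proof (rule matchesE[OF assms(1)], rule matchesE[OF assms(2)])
  fix n :: nat and U s and m :: nat and V t
  assume U': "\<forall>i<n. open (U i) \<and> s i \<in> carrier G \<and> act (s i) ` U i \<subseteq> B1" "C1 \<subseteq> (\<Union>i<n. U i)"
    "\<forall>i<n. \<forall>j<n. i \<noteq> j \<longrightarrow> act (s i) ` U i \<inter> act (s j) ` U j = {}"
    and V': "\<forall>i<m. open (V i) \<and> t i \<in> carrier G \<and> act (t i) ` V i \<subseteq> B2" "C2 \<subseteq> (\<Union>i<m. V i)"
    "\<forall>i<m. \<forall>j<m. i \<noteq> j \<longrightarrow> act (t i) ` V i \<inter> act (t j) ` V j = {}"
  note U = U'[rule_format] and V = V'[rule_format]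
  define W where "W i = (if i < n then U i else V (i - n))" for i
  define r where "r i = (if i < n then s i else t (i - n))" for i
  show ?thesis
    unfolding matches_def
  proof (intro exI[of _ "n + m"] exI[of _ W] exI[of _ r] conjI allI impI)
    fix i assume i: "i < n + m"
    show "open (W i)" "r i \<in> carrier G" "act (r i) ` W i \<subseteq> B1 \<union> B2"
      using U(1)[of i] V(1)[of "i - n"] i by (cases "i < n"; force simp: W_def r_def)+
    fix j assume j: "j < n + m" "i \<noteq> j"
    consider "i < n" "j < n" | "i < n" "\<not> j < n" | "\<not> i < n" "j < n" | "\<not> i < n" "\<not> j < n" by blast
    then show "act (r i) ` W i \<inter> act (r j) ` W j = {}"
    proof cases
      case 1
      then show ?thesis using U(3) j by (simp add: W_def r_def)
    next
      case 2
      then have "act (s i) ` U i \<subseteq> B1" "act (t (j - n)) ` V (j - n) \<subseteq> B2"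
        using U(1)[of i] V(1)[of "j - n"] j by auto
      then show ?thesis using 2 assms(3) by (simp add: W_def r_def) blast
    next
      case 3
      then have "act (s j) ` U j \<subseteq> B1" "act (t (i - n)) ` V (i - n) \<subseteq> B2"
        using U(1)[of j] V(1)[of "i - n"] i by auto
      then show ?thesis using 3 assms(3) by (simp add: W_def r_def) blast
    next
      case 4
      then have "i - n < m" "j - n < m" "i - n \<noteq> j - n" using i j by auto
      then show ?thesis using V(3) 4 by (simp add: W_def r_def)
    qed
  next
    show "C1 \<union> C2 \<subseteq> (\<Union>i<n + m. W i)"
    proof (rule Un_least)
      have "(\<Union>i<n. U i) \<subseteq> (\<Union>i<n + m. W i)"
      proof (rule UN_least)
        fix k assume "k \<in> {..<n}"
        then have "U k = W k" "k < n + m" by (auto simp: W_def)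
        then show "U k \<subseteq> (\<Union>i<n + m. W i)" by blast
      qed
      with U'(2) show "C1 \<subseteq> (\<Union>i<n + m. W i)" by (rule subset_trans)
      have "(\<Union>i<m. V i) \<subseteq> (\<Union>i<n + m. W i)"
      proof (rule UN_least)
        fix k assume "k \<in> {..<m}"
        then have "V k = W (n + k)" "n + k < n + m" by (auto simp: W_def)
        then show "V k \<subseteq> (\<Union>i<n + m. W i)" by blast
      qed
      with V'(2) show "C2 \<subseteq> (\<Union>i<n + m. W i)" by (rule subset_trans)
    qed
  qed
qed

lemma minimal_cases:
  assumes "minimal_action G act" "closed Y" "\<And>g. g \<in> carrier G \<Longrightarrow> act g ` Y \<subseteq> Y"
  shows "Y = {} \<or> Y = UNIV"
  using assms by (simp add: minimal_action_def)

lemma greedy_exists: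
  assumes "\<And>i. g i \<in> carrier G" "closed C" "open B" "0 < \<kappa>"
  obtains \<delta> \<tau> where "greedy_matching G act g C B \<kappa> \<delta> \<tau>"
proof (rule greedy_scales[of g, OF assms(1,4)])
  fix \<delta> \<tau> :: "nat \<Rightarrow> real"
  assume "\<And>k. 0 < \<delta> k" "\<And>k. 2 * \<delta> k \<le> \<kappa>" "\<And>k. \<tau> k \<le> \<kappa>"
    "\<And>k. 2 * \<delta> (Suc k) \<le> \<delta> k"
    "\<And>k x y. dist x y < 2 * \<delta> (Suc k) \<Longrightarrow> dist (act (g k) x) (act (g k) y) < \<tau> k"
    "\<And>k i x y. i \<le> k \<Longrightarrow> dist x y < \<tau> (Suc k) \<Longrightarrow>
      dist (act (inv (g i)) x) (act (inv (g i)) y) < \<delta> k"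
  with assms have "greedy_matching G act g C B \<kappa> \<delta> \<tau>" by unfold_locales
  then show thesis by (rule that)
qed

lemma (in greedy_matching) greedy_matches: "matches (C - rest n) B"
  unfolding matches_def
proof (intro exI[of _ n] exI[of _ piece] exI[of _ g] conjI allI impI)
  fix i
  show "open (piece i)" by (rule open_piece)
  show "g i \<in> carrier G" by (rule g)
  show "act (g i) ` piece i \<subseteq> B"
    using piece_image_room[of i] room_antimono[of 0 i] by (simp add: room_0)
  show "act (g i) ` piece i \<inter> act (g j) ` piece j = {}" if "i \<noteq> j" for j
    using that by (rule piece_image_disjoint)
next
  show "C - rest n \<subseteq> (\<Union>i<n. piece i)" using piece_cover[of n] by blast
qed

end

section \<open>Matching uniformly small sets, finite orbits, and the combination of the two greedy
  procedures\<close>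

context polynomial_action begin

lemma ball_enumeration:
  obtains g :: "nat \<Rightarrow> 'a" and N :: "nat \<Rightarrow> nat"
  where "\<forall>n. g ` {..<N n} = F n" "range g = carrier G"
proof -
  obtain g and N :: "nat \<Rightarrow> nat" where gN: "\<And>n. g ` {..<N n} = F n" "range g = (\<Union>n. F n)"
  proof (rule exhausting_enumeration[of F])
    show "finite (F n)" "F n \<noteq> {}" "F n \<subseteq> F (Suc n)" for n
      using F_finite F_one F_mono[of n "Suc n"] by auto
  qed (rule that)
  have "range g = carrier G" using gN(2) F_exhaust by simp
  then show thesis using gN(1) by (intro that[of g N]) auto
qed

text \<open>The points whose orbit avoids \<open>W\<close> form a closed invariant set that is not
  the whole space, so it is empty by minimality. The preimages of \<open>W\<close> therefore cover
  the space; by compactness finitely many suffice, and their group elements lie in one ball.\<close>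

lemma uniformly_recurrent:
  assumes min: "minimal_action G act" and W: "open W" "W \<noteq> {}"
  obtains R where "\<And>x. \<exists>h\<in>F R. act h x \<in> W"
proof -
  let ?P = "\<lambda>h. act h -` W"
  let ?Y = "- (\<Union>h\<in>carrier G. ?P h)"
  have op: "open (?P h)" if "h \<in> carrier G" for h using act_vimage_open[OF that W(1)] .
  have "closed ?Y" using op by auto
  moreover have "act g ` ?Y \<subseteq> ?Y" if g: "g \<in> carrier G" for g
  proof
    fix z assume "z \<in> act g ` ?Y"
    then obtain y where y: "y \<in> ?Y" "z = act g y" by blast
    have "act h z \<notin> W" if h: "h \<in> carrier G" for h
    proof -
      have "act (h \<otimes> g) y \<notin> W" using y(1) m_closed[OF h g] by blast
      then show ?thesis using y(2) act_mult[OF h g] by simp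
    qed
    then show "z \<in> ?Y" by auto
  qed
  ultimately have "?Y = {} \<or> ?Y = UNIV"
    by (rule minimal_cases[OF min])
  moreover have "?Y \<noteq> UNIV"
  proof -
    obtain b where "b \<in> W" using W(2) by blast
    then have "b \<in> ?P \<one>" by simp
    then show ?thesis using one_closed by blast
  qed
  ultimately have "UNIV \<subseteq> (\<Union>h\<in>carrier G. ?P h)" by blast
  then obtain D where D: "D \<subseteq> carrier G" "finite D" "UNIV \<subseteq> (\<Union>h\<in>D. ?P h)"
    using compactE_image[OF compact_UNIV, of "carrier G" ?P] op by blast
  have "\<exists>R. D \<subseteq> F R"
    using D(2,1)
  proof (induction D rule: finite_induct)
    case (insert h D)
    then obtain R where "D \<subseteq> F R" by auto
    moreover obtain R' where "h \<in> F R'" using insert.prems F_exhaust by blast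
    ultimately have "insert h D \<subseteq> F (max R R')"
      using F_mono[of R "max R R'"] F_mono[of R' "max R R'"] by auto
    then show ?case by blast
  qed simp
  then obtain R where "D \<subseteq> F R" by blast
  then have "\<exists>h\<in>F R. act h x \<in> W" for x using D(3) by blast
  then show thesis by (rule that)
qed

text \<open>Each point of the smaller ball is moved into \<open>W\<close> by an element of
  \<open>F R\<close> without leaving the larger ball, and it can be recovered from that element and
  the point reached.\<close>

lemma visits_orbit_ball:
  assumes R: "\<And>x. \<exists>h\<in>F R. act h x \<in> W" and "R \<le> n"
  shows "card (orbit_ball (n - R) x) \<le> card (F R) * card (W \<inter> orbit_ball n x)"
proof -
  obtain h where h: "\<And>z. h z \<in> F R \<and> act (h z) z \<in> W" using R by metis
  let ?f = "\<lambda>z. (h z, act (h z) z)"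
  have "inj_on ?f (orbit_ball (n - R) x)"
    by (intro inj_onI) (metis Pair_inject F_carrier act_inv(1) h)
  moreover have "?f ` orbit_ball (n - R) x \<subseteq> F R \<times> (W \<inter> orbit_ball n x)"
  proof
    fix q assume "q \<in> ?f ` orbit_ball (n - R) x"
    then obtain z where z: "z \<in> orbit_ball (n - R) x" "q = ?f z" by blast
    have "act (h z) z \<in> orbit_ball (R + (n - R)) x" using act_orbit_ball h z(1) by blast
    then show "q \<in> F R \<times> (W \<inter> orbit_ball n x)" using z(2) h assms(2) by simp
  qed
  ultimately have "card (orbit_ball (n - R) x) \<le> card (F R \<times> (W \<inter> orbit_ball n x))"
    by (intro card_inj_on_le) (auto simp: F_finite)
  then show ?thesis by (simp add: card_cartesian_product)
qed

lemma invariant_measure_exists: "\<exists>\<mu>. invariant \<mu>"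
proof -
  obtain \<mu> n where "limit_measure (\<lambda>j. frequency (2 * n j) undefined) \<mu>"
    using orbit_limit[of undefined 0] by metis
  then show ?thesis by (auto simp: limit_measure_def)
qed

text \<open>The number \<eta> depends on \<open>V\<close> only and is fixed before \<open>C\<close>
  is known. If some \<open>x\<close> stayed unmatched, recurrence would put many points of the core
  of \<open>V\<close> into the \<open>n\<close>-ball of its orbit, and the charging would find as
  many points near \<open>C\<close> in the \<open>2n\<close>-ball. Doubling makes this a frequency
  of at least \<eta>, which persists in the limit.\<close>

lemma small_matches:
  assumes min: "minimal_action G act" and V: "open V" "V \<noteq> {}"
  obtains \<eta> where "0 < \<eta>"
    "\<forall>C. closed C \<longrightarrow> (\<forall>\<mu>. invariant \<mu> \<longrightarrow> measure \<mu> C < \<eta>) \<longrightarrow> matches C V"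
proof -
  obtain b e where b: "0 < e" "ball b e \<subseteq> V"
    using V open_contains_ball by (metis ex_in_conv)
  define r where "r = e / 2"
  have r: "0 < r" "ball b (2 * r) \<subseteq> V" using b by (auto simp: r_def)
  \<comment> \<open>Half of the radius available in \<open>V\<close>, so that \<open>W\<close> lies
    in the core at scale \<open>r\<close>.\<close>
  define W where "W = ball b r"
  have "open W" "W \<noteq> {}" using r(1) by (auto simp: W_def)
  then obtain R where R: "\<And>x. \<exists>h\<in>F R. act h x \<in> W"
    using uniformly_recurrent[OF min] by blast
  have W_core: "W \<subseteq> inner_core r V"
  proof
    fix y assume y: "y \<in> W"
    have "ball y r \<subseteq> ball b (2 * r)"
    proof
      fix z assume "z \<in> ball y r"
      then show "z \<in> ball b (2 * r)" using y dist_triangle[of b z y] by (auto simp: W_def)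
    qed
    then show "y \<in> inner_core r V" using r(2) by (auto simp: inner_core_def)
  qed
  \<comment> \<open>The first factor is the loss in \<open>visits_orbit_ball\<close>, the second the
    doubling constant of \<open>orbit_limit\<close>.\<close>
  define \<eta> where "\<eta> = 1 / (real (card (F R)) * (2 * 8 ^ p))"
  have cF: "0 < card (F R)" using F_finite[of R] F_one[of R] by (auto simp: card_gt_0_iff)
  have \<eta>: "0 < \<eta>" using cF by (simp add: \<eta>_def)
  have "matches C V" if C: "closed C" and small: "\<And>\<mu>. invariant \<mu> \<Longrightarrow> measure \<mu> C < \<eta>" for C
  proof -
    \<comment> \<open>The empty set brings the smallness of \<open>C\<close> into the form of
      \<open>uniform_margin\<close>, which then yields a neighbourhood of \<open>C\<close> that is
      still small.\<close>
    have "\<And>\<mu>. invariant \<mu> \<Longrightarrow> measure \<mu> C < measure \<mu> {} + \<eta>" using small by simp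
    then obtain \<epsilon> where \<epsilon>: "0 < \<epsilon>"
      "\<And>\<mu>. invariant \<mu> \<Longrightarrow> measure \<mu> (outer_nbhd \<epsilon> C) < measure \<mu> (inner_core \<epsilon> {}) + \<eta>"
      using uniform_margin[OF C open_empty, of \<eta>] by metis
    have "inner_core \<epsilon> {} = {}" using inner_core_subset[OF \<epsilon>(1)] by blast
    then have small': "measure \<mu> (outer_nbhd \<epsilon> C) < \<eta>" if "invariant \<mu>" for \<mu>
      using \<epsilon>(2)[OF that] by simp
    \<comment> \<open>Small enough for the neighbourhood of \<open>C\<close> to keep measure below
      \<eta> and for the core of \<open>V\<close> to contain \<open>W\<close>.\<close>
    define \<kappa> where "\<kappa> = min \<epsilon> r"
    have \<kappa>: "0 < \<kappa>" using \<epsilon>(1) r(1) by (simp add: \<kappa>_def)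
    obtain g :: "nat \<Rightarrow> 'a" and N where "\<forall>n. g ` {..<N n} = F n" and range: "range g = carrier G"
      using ball_enumeration by blast
    then have gN: "g ` {..<N n} = F n" for n by blast
    have g: "g i \<in> carrier G" for i using range by blast
    obtain \<delta> \<tau> where "greedy_matching G act g C V \<kappa> \<delta> \<tau>"
      using greedy_exists[of g, OF g C V(1) \<kappa>] by blast
    then interpret greedy_matching G act g C V \<kappa> \<delta> \<tau> .
    have "(\<Inter>k. rest k) = {}"
    proof (rule ccontr)
      assume "(\<Inter>k. rest k) \<noteq> {}"
      then obtain x where x: "x \<in> (\<Inter>k. rest k)" by blast
      obtain \<mu> n where lim: "limit_measure (\<lambda>j. frequency (2 * n j) x) \<mu>"
        and n: "\<And>j. R \<le> n j"
          "\<And>j. card (orbit_ball (2 * n j) x) \<le> 2 * 8 ^ p * card (orbit_ball (n j - R) x)"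
        using orbit_limit[of x R] by metis
      have "\<eta> \<le> frequency (2 * n j) x (outer_nbhd \<epsilon> C)" for j
      proof -
        let ?m = "n j"
        have "card (W \<inter> orbit_ball ?m x) \<le> card (inner_core \<kappa> V \<inter> orbit_ball ?m x)"
          using W_core inner_core_antimono[of \<kappa> r V] by (intro card_mono) (auto simp: \<kappa>_def)
        also have "\<dots> \<le> card (outer_nbhd \<kappa> C \<inter> (\<lambda>(f, h). act (inv f) (act h x)) ` (F ?m \<times> F ?m))"
          unfolding orbit_ball_def by (rule unmatched_card_le[OF x F_finite gN[symmetric]])
        also have "\<dots> \<le> card (outer_nbhd \<epsilon> C \<inter> orbit_ball (2 * ?m) x)"
        proof (rule card_mono)
          have "act (inv f) (act h x) \<in> orbit_ball (2 * ?m) x" if "f \<in> F ?m" "h \<in> F ?m" for f h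
          proof -
            have "act h x \<in> orbit_ball ?m x" using that by (auto simp: orbit_ball_def)
            then show ?thesis using act_orbit_ball[OF F_inv[OF that(1)]] by (simp add: mult_2)
          qed
          moreover have "outer_nbhd \<kappa> C \<subseteq> outer_nbhd \<epsilon> C" by (rule outer_nbhd_mono) (simp add: \<kappa>_def)
          ultimately show "outer_nbhd \<kappa> C \<inter> (\<lambda>(f, h). act (inv f) (act h x)) ` (F ?m \<times> F ?m)
              \<subseteq> outer_nbhd \<epsilon> C \<inter> orbit_ball (2 * ?m) x" by auto
        qed simp
        finally have "card (orbit_ball (?m - R) x)
            \<le> card (F R) * card (outer_nbhd \<epsilon> C \<inter> orbit_ball (2 * ?m) x)"
          using visits_orbit_ball[OF R n(1), of j x] by (meson mult_le_mono2 order_trans)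
        then have "card (orbit_ball (2 * ?m) x)
            \<le> 2 * 8 ^ p * (card (F R) * card (outer_nbhd \<epsilon> C \<inter> orbit_ball (2 * ?m) x))"
          using n(2)[of j] by (meson mult_le_mono2 order_trans)
        then have "real (card (orbit_ball (2 * ?m) x))
            \<le> real (2 * 8 ^ p * (card (F R) * card (outer_nbhd \<epsilon> C \<inter> orbit_ball (2 * ?m) x)))"
          by (rule of_nat_mono)
        then show ?thesis
          using card_orbit_ball_pos[of "2 * ?m" x] cF
          by (simp add: \<eta>_def frequency_def field_simps)
      qed
      then have "measure \<mu> {} + \<eta> \<le> measure \<mu> (outer_nbhd \<epsilon> C)"
        by (intro limit_measureD[OF lim] closed_outer_nbhd C always_eventually)
          (auto simp: frequency_def)
      moreover have "measure \<mu> (outer_nbhd \<epsilon> C) < \<eta>"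
        using lim by (intro small') (simp add: limit_measure_def)
      ultimately show False by simp
    qed
    \<comment> \<open>Nested nonempty closed sets have a common point by compactness, so some
      \<open>rest n\<close> is empty and finitely many steps match all of \<open>C\<close>.\<close>
    moreover have "(UNIV :: 'x set) \<inter> (\<Inter>k\<in>UNIV. rest k) \<noteq> {}" if ne: "\<And>n. rest n \<noteq> {}"
    proof (rule compact_imp_fip_image[OF compact_UNIV closed_rest])
      fix I :: "nat set" assume I: "finite I"
      have "rest (Max (insert 0 I)) \<subseteq> (\<Inter>k\<in>I. rest k)"
        using I by (intro INT_greatest rest_antimono) auto
      then show "UNIV \<inter> (\<Inter>k\<in>I. rest k) \<noteq> {}" using ne[of "Max (insert 0 I)"] by auto
    qed
    ultimately obtain n where "rest n = {}" by auto
    then show "matches C V" using greedy_matches[of n] by simp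
  qed
  then have "\<forall>C. closed C \<longrightarrow> (\<forall>\<mu>. invariant \<mu> \<longrightarrow> measure \<mu> C < \<eta>) \<longrightarrow> matches C V"
    by simp
  with \<eta> show thesis by (rule that)
qed

text \<open>All points of the orbit carry the same mass, so arbitrarily many of them would exceed
  total mass 1.\<close>

lemma null_singleton:
  assumes b: "infinite {act h b | h. h \<in> carrier G}" and \<mu>: "invariant \<mu>"
  shows "measure \<mu> {b} = 0"
proof (rule ccontr)
  interpret prob_space \<mu> by (rule invariantD[OF \<mu>])
  have sets: "sets \<mu> = sets borel" by (rule invariantD[OF \<mu>])
  assume "measure \<mu> {b} \<noteq> 0"
  then have pos: "0 < measure \<mu> {b}" by (simp add: zero_less_measure_iff)
  have atom: "measure \<mu> {act h b} = measure \<mu> {b}" if h: "h \<in> carrier G" for h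
  proof -
    have "act h -` {act h b} = {b}" using inj_act[OF h] by (auto dest: injD)
    then show ?thesis using invariantD(4)[OF \<mu> h, of "{act h b}"] by simp
  qed
  obtain k :: nat where k: "1 < real k * measure \<mu> {b}"
    using reals_Archimedean3[OF pos] by blast
  obtain T where T: "finite T" "card T = k" "T \<subseteq> {act h b | h. h \<in> carrier G}"
    using infinite_arbitrarily_large[OF b] by blast
  have "measure \<mu> T = (\<Sum>x\<in>T. measure \<mu> {x})"
    using T(1) by (intro finite_measure_eq_sum_singleton) (auto simp: sets)
  also have "\<dots> = (\<Sum>x\<in>T. measure \<mu> {b})"
    using T(3) atom by (intro sum.cong) auto
  also have "\<dots> = real k * measure \<mu> {b}" using T(2) by simp
  finally show False using k prob_le_1[of T] by simp
qed

text \<open>By minimality the space is this one finite orbit, with the discrete topology. The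
  uniform measure is invariant, so \<open>less\<close> compares cardinalities, and by transitivity
  an injection of \<open>C\<close> into \<open>B\<close> is realised by group elements acting on
  single points. Here points have positive mass, so no ball could be reserved at negligible
  cost.\<close>

lemma finite_orbit_matches:
  assumes min: "minimal_action G act" and fin: "finite {act h b | h. h \<in> carrier G}"
    and less: "\<And>\<mu>. invariant \<mu> \<Longrightarrow> measure \<mu> C < measure \<mu> B"
  shows "matches C B"
proof -
  let ?Y = "{act h b | h. h \<in> carrier G}"
  have "act g ` ?Y \<subseteq> ?Y" if g: "g \<in> carrier G" for g
  proof
    fix z assume "z \<in> act g ` ?Y"
    then obtain h where "h \<in> carrier G" "z = act g (act h b)" by blast
    then show "z \<in> ?Y" using g act_mult[of g h b] by (auto intro!: exI[of _ "g \<otimes> h"])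
  qed
  with finite_imp_closed[OF fin] have "?Y = {} \<or> ?Y = UNIV" by (rule minimal_cases[OF min])
  moreover have "b \<in> ?Y" using act_one one_closed by (metis (mono_tags, lifting) mem_Collect_eq)
  ultimately have Y: "?Y = UNIV" by blast
  then have fin_UNIV: "finite (UNIV :: 'x set)" using fin by simp
  have finite: "finite A" for A :: "'x set" by (rule finite_subset[OF subset_UNIV fin_UNIV])
  then have closed: "closed A" for A :: "'x set" by (rule finite_imp_closed)
  have op: "open A" for A :: "'x set" using closed[of "- A"] by (simp add: open_closed)
  define \<mu> :: "'x measure" where "\<mu> = uniform_count_measure UNIV"
  have meas: "measure \<mu> A = real (card A) / real (card (UNIV :: 'x set))" for A
    unfolding \<mu>_def using fin_UNIV by (intro measure_uniform_count_measure) auto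
  have "invariant \<mu>"
    unfolding invariant_prob_measure_def
  proof (intro conjI ballI)
    show "prob_space \<mu>" unfolding \<mu>_def using fin_UNIV by (intro prob_space_uniform_count_measure) auto
    have "sets (borel :: 'x measure) = UNIV" using closed by (auto intro: borel_closed)
    then show "sets \<mu> = sets borel" by (simp add: \<mu>_def sets_uniform_count_measure)
    fix h A assume h: "h \<in> carrier G"
    have "card (act h -` A) = card (act (inv h) ` A)" using act_image[of "inv h" A] h by simp
    also have "\<dots> = card A"
      by (rule card_image[OF inj_on_subset[OF inj_act[OF inv_closed[OF h]] subset_UNIV]])
    finally have "card (act h -` A) = card A" .
    then show "measure \<mu> (act h -` A) = measure \<mu> A" by (simp add: meas)
  qed
  from less[OF this] have "real (card C) / real (card (UNIV :: 'x set)) < real (card B) / real (card (UNIV :: 'x set))"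
    by (simp only: meas)
  then have "card C < card B" using fin_UNIV by (simp add: divide_less_cancel card_gt_0_iff)
  then obtain f where f: "f ` C \<subseteq> B" "inj_on f C"
    using card_le_inj[OF finite[of C] finite[of B]] by auto
  have "\<exists>h. h \<in> carrier G \<and> act h x = y" for x y
  proof -
    have "x \<in> ?Y" "y \<in> ?Y" unfolding Y by simp_all
    then obtain k l where kl: "k \<in> carrier G" "x = act k b" "l \<in> carrier G" "y = act l b"
      by blast
    then have "act (l \<otimes> inv k) x = y" by (simp add: act_mult)
    then show ?thesis using kl by blast
  qed
  then have "\<forall>x. \<exists>h. h \<in> carrier G \<and> act h x = f x" by simp
  from choice[OF this] obtain h where h: "\<And>x. h x \<in> carrier G \<and> act (h x) x = f x" by auto
  obtain e where e: "bij_betw e {..<card C} C"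
    using ex_bij_betw_nat_finite[OF finite[of C]] by (auto simp: lessThan_atLeast0)
  show ?thesis
    unfolding matches_def
  proof (intro exI[of _ "card C"] exI[of _ "\<lambda>i. {e i}"] exI[of _ "\<lambda>i. h (e i)"] conjI allI impI)
    fix i assume i: "i < card C"
    show "open {e i}" by (rule op)
    show "h (e i) \<in> carrier G" using h by blast
    have ei: "e i \<in> C" using i e by (auto simp: bij_betw_def)
    show "act (h (e i)) ` {e i} \<subseteq> B" using h f ei by auto
    fix j assume j: "j < card C" "i \<noteq> j"
    have "e j \<in> C" "e i \<noteq> e j" using i j e by (auto simp: bij_betw_def inj_on_def)
    then have "f (e i) \<noteq> f (e j)" using ei f(2) by (auto simp: inj_on_def)
    then show "act (h (e i)) ` {e i} \<inter> act (h (e j)) ` {e j} = {}" using h by auto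
  next
    show "C \<subseteq> (\<Union>i<card C. {e i})" using e by (auto simp: bij_betw_def)
  qed
qed

lemma comparison:
  assumes min: "minimal_action G act" and C: "closed C" and B: "open B"
    and less: "\<And>\<mu>. invariant \<mu> \<Longrightarrow> measure \<mu> C < measure \<mu> B"
  shows "matches C B"
proof -
  obtain \<mu>0 where \<mu>0: "invariant \<mu>0" using invariant_measure_exists by blast
  have "B \<noteq> {}" using less[OF \<mu>0] by (auto simp: not_less)
  then obtain b where b: "b \<in> B" by blast
  show ?thesis
  proof (cases "finite {act h b | h. h \<in> carrier G}")
    case True
    then show ?thesis using finite_orbit_matches[OF min] less by blast
  next
    case False
    \<comment> \<open>Points of an infinite orbit are null, so \<open>b\<close> can be taken out of
      \<open>B\<close> without loss; the margin then leaves space for a whole ball around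
      it.\<close>
    have "measure \<mu> C < measure \<mu> (B - {b}) + 0" if \<mu>: "invariant \<mu>" for \<mu>
    proof -
      interpret prob_space \<mu> by (rule invariantD[OF \<mu>])
      have "measure \<mu> (B - {b}) = measure \<mu> B - measure \<mu> {b}"
        using b B invariantD(2)[OF \<mu>] by (intro finite_measure_Diff) auto
      then show ?thesis using less[OF \<mu>] null_singleton[OF False \<mu>] by simp
    qed
    moreover have "open (B - {b})" using B by (intro open_Diff) auto
    ultimately obtain \<epsilon> where \<epsilon>: "0 < \<epsilon>"
      "\<And>\<mu>. invariant \<mu> \<Longrightarrow> measure \<mu> (outer_nbhd \<epsilon> C) < measure \<mu> (inner_core \<epsilon> (B - {b})) + 0"
      using uniform_margin[OF C, of "B - {b}" 0] by metis
    \<comment> \<open>Half of \<open>\<epsilon>\<close>: a point \<open>y\<close> of the core has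
      distance at least \<open>\<epsilon>\<close> from \<open>b\<close>, so the ball of radius
      \<open>\<kappa>\<close> around \<open>y\<close> misses
      \<open>cball b \<kappa>\<close>.\<close>
    define \<kappa> where "\<kappa> = \<epsilon> / 2"
    have small: "0 < \<kappa>" "\<kappa> \<le> \<epsilon>" using \<epsilon>(1) by (auto simp: \<kappa>_def)
    \<comment> \<open>\<open>B1\<close> receives all but a small part of \<open>C\<close>, and
      \<open>V\<close> is the reserve for that part.\<close>
    define B1 where "B1 = B - cball b \<kappa>"
    define V where "V = B \<inter> ball b \<kappa>"
    have B1: "open B1" using B by (auto simp: B1_def intro!: open_Diff)
    have V: "open V" "V \<noteq> {}" using B b small(1) by (auto simp: V_def)
    have core: "inner_core \<epsilon> (B - {b}) \<subseteq> inner_core \<kappa> B1"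
    proof
      fix y assume y: "y \<in> inner_core \<epsilon> (B - {b})"
      have "b \<notin> ball y \<epsilon>" using y by (auto simp: inner_core_def)
      then have "z \<in> B1" if "z \<in> ball y \<kappa>" for z
        using that y small(2) dist_triangle[of y b z]
        by (auto simp: B1_def inner_core_def \<kappa>_def dist_commute subset_iff)
      then show "y \<in> inner_core \<kappa> B1" by (auto simp: inner_core_def)
    qed
    obtain g :: "nat \<Rightarrow> 'a" and N where "\<forall>n. g ` {..<N n} = F n" and range: "range g = carrier G"
      using ball_enumeration by blast
    have g: "g i \<in> carrier G" for i using range by blast
    obtain \<delta> \<tau> where "greedy_matching G act g C B1 \<kappa> \<delta> \<tau>"
      using greedy_exists[of g, OF g C B1 small(1)] by blast
    then interpret greedy_matching G act g C B1 \<kappa> \<delta> \<tau> .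
    have margin: "measure \<mu> (outer_nbhd \<kappa> C) < measure \<mu> (inner_core \<kappa> B1)" if \<mu>: "invariant \<mu>" for \<mu>
    proof -
      interpret prob_space \<mu> by (rule invariantD[OF \<mu>])
      have sets: "sets \<mu> = sets borel" by (rule invariantD[OF \<mu>])
      have "measure \<mu> (outer_nbhd \<kappa> C) \<le> measure \<mu> (outer_nbhd \<epsilon> C)"
        using outer_nbhd_mono[OF small(2)] closed_outer_nbhd[OF C]
        by (intro finite_measure_mono) (auto simp: sets)
      moreover have "measure \<mu> (inner_core \<epsilon> (B - {b})) \<le> measure \<mu> (inner_core \<kappa> B1)"
        using core closed_inner_core by (intro finite_measure_mono) (auto simp: sets borel_closed)
      ultimately show ?thesis using \<epsilon>(2)[OF \<mu>] by simp
    qed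
    obtain \<eta> where \<eta>: "0 < \<eta>"
      "\<forall>C. closed C \<longrightarrow> (\<forall>\<mu>. invariant \<mu> \<longrightarrow> measure \<mu> C < \<eta>) \<longrightarrow> matches C V"
      using small_matches[OF min V] by metis
    \<comment> \<open>The number of steps is chosen after \<eta>, which is possible because \<eta>
      depends on \<open>V\<close> alone.\<close>
    obtain n where "\<forall>\<mu>. invariant \<mu> \<longrightarrow> measure \<mu> (rest n) < \<eta>"
      using unmatched_small[OF margin range \<eta>(1)] by metis
    then have "matches (rest n) V" using \<eta>(2) closed_rest by simp
    then have "matches ((C - rest n) \<union> rest n) (B1 \<union> V)"
      by (intro matches_Un greedy_matches) (auto simp: B1_def V_def)
    then show ?thesis
      by (rule matches_mono) (auto simp: B1_def V_def)
  qed
qed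

end

theorem theoremA:
  fixes G :: "('g, 'b) monoid_scheme"
    and act :: "'g \<Rightarrow> 'x::metric_space \<Rightarrow> 'x"
  assumes "group G"
    and "finitely_generated_group G"
    and "polynomial_growth G"
    and "compact (UNIV :: 'x set)"
    and "continuous_action G act"
    and "minimal_action G act"
  shows "\<forall>A B. open A \<and> open B \<and>
           (\<forall>\<mu>. invariant_prob_measure G act \<mu> \<longrightarrow> measure \<mu> A < measure \<mu> B)
           \<longrightarrow> subequivalent G act A B"
proof -
  interpret compact_action G act
    using assms by (simp add: compact_action_def compact_action_axioms_def)
  obtain S and c d :: real where S: "finite S" "S \<subseteq> carrier G" "\<And>s. s \<in> S \<Longrightarrow> inv\<^bsub>G\<^esub> s \<in> S"
    "generate G S = carrier G"
    and growth: "\<And>n. 1 \<le> n \<Longrightarrow> real (card (word_ball G S n)) \<le> c * real n powr d"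
    using assms(3) unfolding polynomial_growth_def by blast
  \<comment> \<open>The bound is brought to a natural exponent and a nonnegative constant; rounding
    \<open>d\<close> up, or up to 0 if it is negative, only enlarges the powers of a radius at least
    1.\<close>
  have growth': "real (card (word_ball G S n)) \<le> \<bar>c\<bar> * real n ^ nat \<lceil>d\<rceil>" if n: "1 \<le> n" for n
  proof -
    have "real n powr d \<le> real n powr real (nat \<lceil>d\<rceil>)"
      using n by (intro powr_mono) linarith+
    also have "\<dots> = real n ^ nat \<lceil>d\<rceil>" using n by (simp add: powr_realpow)
    finally have "c * real n powr d \<le> \<bar>c\<bar> * real n ^ nat \<lceil>d\<rceil>"
      by (intro mult_mono) auto
    then show ?thesis using growth[OF n] by simp
  qed
  interpret polynomial_action G act "word_ball G S" "\<bar>c\<bar>" "nat \<lceil>d\<rceil>"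
  proof
    show "finite (word_ball G S n)" for n by (rule finite_word_ball[OF S(2,1)])
    show "\<one>\<^bsub>G\<^esub> \<in> word_ball G S n" for n by (rule one_word_ball[OF S(2)])
    show "a \<otimes>\<^bsub>G\<^esub> b \<in> word_ball G S (m + n)" if "a \<in> word_ball G S m" "b \<in> word_ball G S n" for a b m n
      by (rule word_ball_mult[OF S(2) that])
    show "inv\<^bsub>G\<^esub> a \<in> word_ball G S n" if "a \<in> word_ball G S n" for a n
      by (rule word_ball_inv[OF S(2,3) that])
    show "(\<Union>n. word_ball G S n) = carrier G"
      using word_balls_exhaust[OF S(2,3)] S(4) by simp
    show "real (card (word_ball G S n)) \<le> \<bar>c\<bar> * real n ^ nat \<lceil>d\<rceil>" if "1 \<le> n" for n
      by (rule growth'[OF that])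
  qed
  show ?thesis
  proof (intro allI impI)
    fix A B :: "'x set"
    assume AB: "open A \<and> open B \<and> (\<forall>\<mu>. invariant \<mu> \<longrightarrow> measure \<mu> A < measure \<mu> B)"
    have "matches C B" if C: "closed C" "C \<subseteq> A" for C
    proof (rule comparison[OF assms(6) C(1)])
      show "open B" using AB by blast
      fix \<mu> assume \<mu>: "invariant \<mu>"
      interpret prob_space \<mu> by (rule invariantD[OF \<mu>])
      have "measure \<mu> C \<le> measure \<mu> A"
        using C AB invariantD(2)[OF \<mu>] by (intro finite_measure_mono) auto
      then show "measure \<mu> C < measure \<mu> B" using AB \<mu> by fastforce
    qed
    then show "subequivalent G act A B" by (simp add: subequivalent_iff)
  qed
qed

end
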